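(* Let $N\ge 2$, $\alpha\in(0,2)$, $C_1,C_2\ge 1$, $\hat c>0$. There exists a constant $\gamma$ depending only on $C_1,C_2,N,\alpha,\hat c$ such that the following holds. Let $E\subset\mathbb{R}^N$ be a bounded domain and let $\mu(x,dy)=K(x,y)\,dy$, where $K:\mathbb{R}^N\times\mathbb{R}^N\to[0,\infty)$ is measurable with $K(x,y)=K(y,x)$ for all $x,y\in\mathbb{R}^N$, be such that $\mu$ is symmetric, satisfies the Poincaré inequality in $E$ with constant $C_1$, satisfies the decay estimate with constant $C_2$, and $K$ satisfies the UJS inequality with constant $\hat c$. Let $B_R(x_0)\subset E$ and let $u$ be a local weak sub-solution of $\mathscr{L}u=0$ in $E$ such that $u\ge0$ in $B_R(x_0)$. Then, for any $0<r<R$ and any $\delta\in(0,1]$, $$\sup_{B_{\frac r2}(x_0)}u\le\delta\, r^\alpha\int_{\mathbb{R}^N\setminus B_{\frac r2}(x_0)}\frac{u_+(x)}{|x-x_0|^{N+\alpha}}\,dx+\gamma\,\frac{1}{\delta^{\frac{N}{2\alpha}}}\left(\frac{1}{|B_r(x_0)|}\int_{B_r(x_0)}u_+^2\,dx\right)^{\frac12}.$$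
   Context: $B_r(x_0)$ is the ball of radius $r$ centred at $x_0$ in $\mathbb{R}^N$; $E\subset\mathbb{R}^N$ is a bounded domain; $\alpha\in(0,2)$; $u_+=\max\{u,0\}$. A set is $\mu$-measurable if it is $\mu(x,dy)$-measurable for all $x\in\mathbb{R}^N$. The operator is $\mathscr{L}u(x)=\text{p.v.}\int_{\mathbb{R}^N}(u(x)-u(y))\,\mu(x,dy)$, understood weakly as below. Symmetric: for all disjoint $\mu$-measurable sets $\Omega_1,\Omega_2$, the functions $x\mapsto\int_{\Omega_i}\mu(x,dy)$, $i=1,2$, are Lebesgue measurable and $\int_{\Omega_1}\int_{\Omega_2}\mu(x,dy)dx=\int_{\Omega_2}\int_{\Omega_1}\mu(x,dy)dx$. For open $D\subseteq\mathbb{R}^N$ put $\mathcal{E}_D^\mu(u,\varphi)=\int_D\int_D(u(y)-u(x))(\varphi(y)-\varphi(x))\,\mu(x,dy)dx$ and $\mathcal{E}^\mu=\mathcal{E}^\mu_{\mathbb{R}^N}$. $H^\mu_{\rm loc}(E)$ is the set of functions $u$ such that, for every open $D$ with $\overline{D}\subseteq E$, $u\in L^2(D)$ and $\mathcal{E}_D^\mu(u,u)<\infty$. $H^\mu(\mathbb{R}^N)$ is the space of $u\in L^2(\mathbb{R}^N)$ with $\mathcal{E}^\mu(u,u)<\infty$. Poincaré inequality in $E$ with constant $C_1$: for every ball $B_\rho(x_0)\subset E$ and every $v\in H^\mu_{\rm loc}(E)$, $\int_{B_\rho(x_0)}(v-[v]_{B_\rho(x_0)})^2dx\le C_1\rho^\alpha\mathcal{E}^\mu_{B_\rho(x_0)}(v,v)$,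 where $[v]_{B}$ is the average of $v$ over $B$. Decay estimate with constant $C_2$: for every $x_0\in\mathbb{R}^N$, $r>0$, $\int_{\mathbb{R}^N\setminus B_r(x_0)}\mu(x_0,dy)\le C_2r^{-\alpha}$. UJS inequality with constant $\hat c$: for every $x,y\in\mathbb{R}^N$ and every $0<r\le\frac{|x-y|}{2}$, $K(x,y)\le\hat c\,\frac{1}{|B_r(x)|}\int_{B_r(x)}K(z,y)\,dz$. Local weak sub-solution of $\mathscr{L}u=0$ in $E$: a Lebesgue measurable $u:\mathbb{R}^N\to\mathbb{R}$ with $u\in H^\mu_{\rm loc}(E)$, $\sup_{x\in B_{\frac78R}(x_0)}\int_{\mathbb{R}^N\setminus B_R(x_0)}|u(y)|\,\mu(x,dy)<\infty$ for every $B_R(x_0)\subset E$, and $\mathcal{E}^\mu(u,\varphi)\le0$ for every non-negative $\varphi\in H^\mu(\mathbb{R}^N)$ with $\operatorname{supp}\varphi\subseteq E$. The supremum of $u$ over a ball is the essential supremum (Lebesgue measure). The right-hand side may be $+\infty$, in which case there is nothing to assert. *)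

theory Defs
  imports "HOL-Probability.Essential_Supremum"
begin

text \<open>
  A family of measures \<open>\<mu>(x,dy)\<close> is a function \<open>\<mu>\<close> from points to measures. Integrals of non-negative
  functions are taken in \<^typ>\<open>ennreal\<close>, so that the value \<open>\<infinity>\<close> is kept.
\<close>

definition kernel_measure :: "('a::euclidean_space \<Rightarrow> 'a \<Rightarrow> real) \<Rightarrow> 'a \<Rightarrow> 'a measure" where
  "kernel_measure K x = density lebesgue (\<lambda>y. ennreal (K x y))"

text \<open>
  Joint measurability is Lebesgue measurability on the product space, which gives measurability only
  of almost every section; that every section is measurable is what it takes for
  \<open>K(x,y) dy\<close> to be a measure for every \<open>x\<close>.
\<close>

definition symmetric_kernel :: "('a::euclidean_space \<Rightarrow> 'a \<Rightarrow> real) \<Rightarrow> bool" where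
  "symmetric_kernel K \<longleftrightarrow>
     (\<lambda>(x, y). K x y) \<in> borel_measurable lebesgue \<and>
     (\<forall>x. K x \<in> borel_measurable lebesgue) \<and>
     (\<forall>x y. 0 \<le> K x y) \<and>
     (\<forall>x y. K x y = K y x)"

definition family_measurable :: "('a \<Rightarrow> 'a measure) \<Rightarrow> 'a set \<Rightarrow> bool" where
  "family_measurable \<mu> \<Omega> \<longleftrightarrow> (\<forall>x. \<Omega> \<in> sets (\<mu> x))"

definition symmetric_family :: "('a::euclidean_space \<Rightarrow> 'a measure) \<Rightarrow> bool" where
  "symmetric_family \<mu> \<longleftrightarrow>
     (\<forall>\<Omega>1 \<Omega>2. family_measurable \<mu> \<Omega>1 \<longrightarrow> family_measurable \<mu> \<Omega>2 \<longrightarrow> \<Omega>1 \<inter> \<Omega>2 = {} \<longrightarrow>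
        (\<lambda>x. emeasure (\<mu> x) \<Omega>1) \<in> borel_measurable lebesgue \<and>
        (\<lambda>x. emeasure (\<mu> x) \<Omega>2) \<in> borel_measurable lebesgue \<and>
        (\<integral>\<^sup>+x\<in>\<Omega>1. emeasure (\<mu> x) \<Omega>2 \<partial>lebesgue) = (\<integral>\<^sup>+x\<in>\<Omega>2. emeasure (\<mu> x) \<Omega>1 \<partial>lebesgue))"

definition energy ::
  "('a::euclidean_space \<Rightarrow> 'a measure) \<Rightarrow> 'a set \<Rightarrow> ('a \<Rightarrow> real) \<Rightarrow> ('a \<Rightarrow> real) \<Rightarrow> real" where
  "energy \<mu> D u \<phi> = (LINT x:D|lebesgue. LINT y:D|\<mu> x. (u y - u x) * (\<phi> y - \<phi> x))"

text \<open>The quadratic form \<open>\<E>\<^sub>D(u,u)\<close>, with the value \<open>\<infinity>\<close> allowed.\<close>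

definition energy_sq ::
  "('a::euclidean_space \<Rightarrow> 'a measure) \<Rightarrow> 'a set \<Rightarrow> ('a \<Rightarrow> real) \<Rightarrow> ennreal" where
  "energy_sq \<mu> D u = (\<integral>\<^sup>+x\<in>D. (\<integral>\<^sup>+y\<in>D. ennreal ((u y - u x)\<^sup>2) \<partial>\<mu> x) \<partial>lebesgue)"

definition L2_on :: "'a::euclidean_space set \<Rightarrow> ('a \<Rightarrow> real) set" where
  "L2_on D = {u. u \<in> borel_measurable (lebesgue_on D) \<and> integrable (lebesgue_on D) (\<lambda>x. (u x)\<^sup>2)}"

definition H_loc :: "('a::euclidean_space \<Rightarrow> 'a measure) \<Rightarrow> 'a set \<Rightarrow> ('a \<Rightarrow> real) set" where
  "H_loc \<mu> E = {u. \<forall>D. open D \<longrightarrow> closure D \<subseteq> E \<longrightarrow> u \<in> L2_on D \<and> energy_sq \<mu> D u < \<infinity>}"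

definition H_space :: "('a::euclidean_space \<Rightarrow> 'a measure) \<Rightarrow> ('a \<Rightarrow> real) set" where
  "H_space \<mu> = {u. u \<in> L2_on UNIV \<and> energy_sq \<mu> UNIV u < \<infinity>}"

definition average :: "'a::euclidean_space set \<Rightarrow> ('a \<Rightarrow> real) \<Rightarrow> real" where
  "average B v = (LINT x:B|lebesgue. v x) / measure lebesgue B"

text \<open>
  A ball in \<open>E\<close> may touch the boundary of \<open>E\<close>, so the right-hand side may be \<open>\<infinity>\<close>. If it is finite,
  the inequality on smaller concentric balls forces \<open>v\<close> to be square integrable on the ball, so the
  average is then a genuine one.
\<close>

definition poincare_inequality ::
  "('a::euclidean_space \<Rightarrow> 'a measure) \<Rightarrow> 'a set \<Rightarrow> real \<Rightarrow> real \<Rightarrow> bool" where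
  "poincare_inequality \<mu> E \<alpha> C1 \<longleftrightarrow>
     (\<forall>x0 \<rho>. \<forall>v\<in>H_loc \<mu> E. 0 < \<rho> \<longrightarrow> ball x0 \<rho> \<subseteq> E \<longrightarrow>
        (\<integral>\<^sup>+x\<in>ball x0 \<rho>. ennreal ((v x - average (ball x0 \<rho>) v)\<^sup>2) \<partial>lebesgue)
          \<le> ennreal (C1 * \<rho> powr \<alpha>) * energy_sq \<mu> (ball x0 \<rho>) v)"

definition decay_estimate ::
  "('a::euclidean_space \<Rightarrow> 'a measure) \<Rightarrow> real \<Rightarrow> real \<Rightarrow> bool" where
  "decay_estimate \<mu> \<alpha> C2 \<longleftrightarrow>
     (\<forall>x0 r. 0 < r \<longrightarrow> emeasure (\<mu> x0) (- ball x0 r) \<le> ennreal (C2 * r powr (- \<alpha>)))"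

definition UJS :: "('a::euclidean_space \<Rightarrow> 'a \<Rightarrow> real) \<Rightarrow> real \<Rightarrow> bool" where
  "UJS K c \<longleftrightarrow>
     (\<forall>x y r. 0 < r \<longrightarrow> r \<le> norm (x - y) / 2 \<longrightarrow>
        ennreal (K x y) \<le>
          ennreal (c / measure lebesgue (ball x r)) * (\<integral>\<^sup>+z\<in>ball x r. ennreal (K z y) \<partial>lebesgue))"

text \<open>
  For \<open>u\<close> and \<open>\<phi>\<close> as below, and \<open>\<mu>\<close> symmetric and satisfying the decay estimate, the double integral
  \<open>energy \<mu> UNIV u \<phi>\<close> converges absolutely: \<open>supp \<phi>\<close> is a compact subset of \<open>E\<close>, and the tail condition
  controls the interaction with points outside \<open>E\<close>.
\<close>

definition local_weak_subsolution ::
  "('a::euclidean_space \<Rightarrow> 'a measure) \<Rightarrow> 'a set \<Rightarrow> ('a \<Rightarrow> real) \<Rightarrow> bool" where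
  "local_weak_subsolution \<mu> E u \<longleftrightarrow>
     u \<in> borel_measurable lebesgue \<and>
     u \<in> H_loc \<mu> E \<and>
     (\<forall>x0 R. 0 < R \<longrightarrow> ball x0 R \<subseteq> E \<longrightarrow>
        (SUP x\<in>ball x0 (7 / 8 * R). \<integral>\<^sup>+y\<in>- ball x0 R. ennreal \<bar>u y\<bar> \<partial>\<mu> x) < \<infinity>) \<and>
     (\<forall>\<phi>\<in>H_space \<mu>. (\<forall>x. 0 \<le> \<phi> x) \<longrightarrow> closure {x. \<phi> x \<noteq> 0} \<subseteq> E \<longrightarrow> energy \<mu> UNIV u \<phi> \<le> 0)"

end

theory Submission imports Defs begin

text \<open>
  By symmetry, the UJS inequality and the decay estimate give the pointwise bound
  \<open>K(x,y) \<le> \<Lambda> |x - y|\<^sup>-\<^sup>N\<^sup>-\<^sup>\<alpha>\<close>, which controls the influence of far points on a truncation of \<open>u\<close> by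
  the tail integral. The Poincare inequality on the balls \<open>B\<^sub>s(z)\<close>, integrated over \<open>z\<close>, yields a
  Faber--Krahn inequality \<open>\<integral> v\<^sup>2 \<le> C s\<^sup>\<alpha> \<E>(v,v)\<close> as soon as \<open>{v \<noteq> 0}\<close> has at most half the measure of
  \<open>B\<^sub>s\<close>, so no Sobolev embedding is needed. Both are combined in a De Giorgi iteration on shrinking
  balls and rising levels; choosing the final level \<open>k \<ge> \<delta> r\<^sup>\<alpha> \<cdot> tail\<close> makes the tail cost only a
  factor \<open>1/\<delta>\<close> in the energy, which gives the exponent \<open>N / (2\<alpha>)\<close>.
\<close>

subsection \<open>Lebesgue measure on product spaces\<close>

text \<open>Joint measurability of \<open>K\<close> is only Lebesgue measurability on the product
  space, so exchanging integrals goes through Borel versions. The weak form \<open>energy\<close> is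
  an iterated signed integral, whereas the estimates concern non-negative ones; it must first be
  shown to converge absolutely, and this is where the tail condition with its radius 7/8 enters.

  The iteration is linear instead of a superlinear recursion. At step j the Faber--Krahn radius is
  s_j = s_0 q^j. It must be small, since the gain s_j^\<alpha> has to beat an energy factor b^j /
  (\<delta> r^\<alpha>), and large, since the ball of radius s_j must dominate the measure of the
  set above the next level, which Chebyshev bounds by a multiple of 4^j / k^2 times the current
  excess. With q^\<alpha> b = 1 and decay rate \<eta> = q^N / 4 of the excess, both demands become
  independent of j. What remains is s_0^\<alpha> proportional to \<delta> r^\<alpha> and k^2 s_0^N
  at least a multiple of the initial square integral, so k^2 scales like \<delta>^(-N/\<alpha>)
  times the mean square.\<close>

lemma AE_lebesgue_prod:
  assumes "AE z in (lebesgue :: ('a::euclidean_space \<times> 'b::euclidean_space) measure). P z"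
  shows "AE x in lebesgue. AE y in lebesgue. P (x, y)"
proof -
  have "AE z in (lborel \<Otimes>\<^sub>M lborel :: ('a \<times> 'b) measure). P z"
    unfolding lborel_prod using assms by (simp add: AE_completion_iff)
  then have "AE x in lborel. AE y in lborel. P (x, y)"
    by (rule lborel_pair.AE_pair)
  then show ?thesis
    by (simp add: AE_completion_iff)
qed

text \<open>\<open>lebesgue\<close> on a product is the completion of the product of the
  \<open>lborel\<close> measures, not a product of completions, so Tonelli is applied to a Borel
  version \<open>g\<close>. For almost every \<open>x\<close> the sections of \<open>f\<close> and
  \<open>g\<close> agree almost everywhere, which is enough for iterated integrals.\<close>

lemma nn_integral_lebesgue_prod:
  fixes f :: "'a::euclidean_space \<times> 'b::euclidean_space \<Rightarrow> ennreal"
  assumes "f \<in> borel_measurable lebesgue"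
  shows "(\<integral>\<^sup>+x. \<integral>\<^sup>+y. f (x, y) \<partial>lebesgue \<partial>lebesgue) = integral\<^sup>N lebesgue f"
proof -
  obtain g where g: "g \<in> borel_measurable lborel" and ae: "AE z in lborel. f z = g z"
    using completion_ex_borel_measurable[OF assms] by auto
  have "AE x in lebesgue. AE y in lebesgue. f (x, y) = g (x, y)"
    using ae by (intro AE_lebesgue_prod AE_completion)
  then have "(\<integral>\<^sup>+x. \<integral>\<^sup>+y. f (x, y) \<partial>lebesgue \<partial>lebesgue) = (\<integral>\<^sup>+x. \<integral>\<^sup>+y. g (x, y) \<partial>lebesgue \<partial>lebesgue)"
    by (intro nn_integral_cong_AE) (auto elim!: eventually_mono intro!: nn_integral_cong_AE)
  also have "\<dots> = (\<integral>\<^sup>+z. g z \<partial>(lborel \<Otimes>\<^sub>M lborel))"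
    unfolding nn_integral_completion using g by (intro lborel.nn_integral_fst) (simp add: lborel_prod)
  also have "\<dots> = (\<integral>\<^sup>+z. f z \<partial>lebesgue)"
    unfolding lborel_prod nn_integral_completion using ae by (intro nn_integral_cong_AE) auto
  finally show ?thesis .
qed

lemma nn_integral_lebesgue_prod_swap:
  fixes f :: "'a::euclidean_space \<times> 'b::euclidean_space \<Rightarrow> ennreal"
  assumes "f \<in> borel_measurable lebesgue"
  shows "(\<integral>\<^sup>+z. f (snd z, fst z) \<partial>lebesgue) = integral\<^sup>N lebesgue f"
proof -
  obtain g where g [measurable]: "g \<in> borel_measurable (borel \<Otimes>\<^sub>M borel)" and ae: "AE z in lborel. f z = g z"
    using completion_ex_borel_measurable[OF assms] by (auto simp: borel_prod)
  have "distr (lborel \<Otimes>\<^sub>M lborel :: ('b \<times> 'a) measure) (lborel \<Otimes>\<^sub>M lborel) (\<lambda>(x, y). (y, x))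
      = (lborel \<Otimes>\<^sub>M lborel :: ('a \<times> 'b) measure)"
    by (rule lborel_pair.distr_pair_swap[symmetric])
  then have dist: "distr (lborel :: ('b \<times> 'a) measure) (lborel :: ('a \<times> 'b) measure) (\<lambda>(x, y). (y, x)) = lborel"
    by (simp add: lborel_prod)
  have m: "(\<lambda>(x, y). (y, x)) \<in> measurable (lborel :: ('b \<times> 'a) measure) (lborel :: ('a \<times> 'b) measure)"
    unfolding lborel_prod[symmetric] by measurable
  have g': "g \<in> borel_measurable lborel"
    using g by (simp add: borel_prod)
  have "AE z in distr (lborel :: ('b \<times> 'a) measure) lborel (\<lambda>(x, y). (y, x)). f z = g z"
    unfolding dist by (rule ae)
  then have "AE z in lborel. f ((\<lambda>(x, y). (y, x)) z) = g ((\<lambda>(x, y). (y, x)) z)"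
    by (rule AE_distrD[OF m])
  then have "(\<integral>\<^sup>+z. f (snd z, fst z) \<partial>lebesgue) = (\<integral>\<^sup>+z. g ((\<lambda>(x, y). (y, x)) z) \<partial>lborel)"
    unfolding nn_integral_completion by (intro nn_integral_cong_AE) (auto simp: case_prod_beta)
  also have "\<dots> = (\<integral>\<^sup>+z. g z \<partial>distr lborel lborel (\<lambda>(x, y). (y, x)))"
    using g' by (simp add: nn_integral_distr[OF m])
  also have "\<dots> = (\<integral>\<^sup>+z. f z \<partial>lebesgue)"
    unfolding dist nn_integral_completion using ae by (intro nn_integral_cong_AE) auto
  finally show ?thesis .
qed

text \<open>With a completed target, Borel measurability is not enough: null sets must pull back to
  null sets. Here they do, because a cylinder over a null set has product measure 0.\<close>

lemma measurable_lebesgue_fst [measurable]: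
  "fst \<in> measurable (lebesgue :: ('a::euclidean_space \<times> 'b::euclidean_space) measure) lebesgue"
proof (rule completion.measurable_completion2)
  show m: "fst \<in> measurable (lebesgue :: ('a \<times> 'b) measure) lborel"
    by (rule measurable_completion) (simp add: lborel_prod[symmetric])
  show "null_sets lborel \<subseteq> null_sets (distr (lebesgue :: ('a \<times> 'b) measure) lborel fst)"
  proof
    fix S :: "'a set" assume S: "S \<in> null_sets lborel"
    have "emeasure (lborel \<Otimes>\<^sub>M lborel :: ('a \<times> 'b) measure) (S \<times> UNIV) = 0"
      using S by (subst lborel.emeasure_pair_measure_Times) auto
    then have "S \<times> UNIV \<in> null_sets (lborel :: ('a \<times> 'b) measure)"
      using S by (auto simp: null_sets_def lborel_prod intro!: borel_Times)
    then have "S \<times> UNIV \<in> null_sets (lebesgue :: ('a \<times> 'b) measure)"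
      by (rule null_sets_completionI)
    moreover have "fst -` S \<inter> space (lebesgue :: ('a \<times> 'b) measure) = S \<times> UNIV"
      by auto
    ultimately show "S \<in> null_sets (distr (lebesgue :: ('a \<times> 'b) measure) lborel fst)"
      using S m by (simp add: null_sets_def emeasure_distr del: emeasure_completion)
  qed
qed

lemma measurable_lebesgue_snd [measurable]:
  "snd \<in> measurable (lebesgue :: ('a::euclidean_space \<times> 'b::euclidean_space) measure) lebesgue"
proof (rule completion.measurable_completion2)
  show m: "snd \<in> measurable (lebesgue :: ('a \<times> 'b) measure) lborel"
    by (rule measurable_completion) (simp add: lborel_prod[symmetric])
  show "null_sets lborel \<subseteq> null_sets (distr (lebesgue :: ('a \<times> 'b) measure) lborel snd)"
  proof
    fix S :: "'b set" assume S: "S \<in> null_sets lborel"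
    have "emeasure (lborel \<Otimes>\<^sub>M lborel :: ('a \<times> 'b) measure) (UNIV \<times> S) = 0"
      using S by (subst lborel.emeasure_pair_measure_Times) auto
    then have "UNIV \<times> S \<in> null_sets (lborel :: ('a \<times> 'b) measure)"
      using S by (auto simp: null_sets_def lborel_prod intro!: borel_Times)
    then have "UNIV \<times> S \<in> null_sets (lebesgue :: ('a \<times> 'b) measure)"
      by (rule null_sets_completionI)
    moreover have "snd -` S \<inter> space (lebesgue :: ('a \<times> 'b) measure) = UNIV \<times> S"
      by auto
    ultimately show "S \<in> null_sets (distr (lebesgue :: ('a \<times> 'b) measure) lborel snd)"
      using S m by (simp add: null_sets_def emeasure_distr del: emeasure_completion)
  qed
qed

text \<open>The swap preserves Lebesgue measure, so null sets pull back to null sets.\<close>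

lemma measurable_lebesgue_swap [measurable]:
  "(\<lambda>z. (snd z, fst z)) \<in> measurable (lebesgue :: ('a::euclidean_space \<times> 'b::euclidean_space) measure) lebesgue"
proof (rule completion.measurable_completion2)
  have swap: "(\<lambda>z. (snd z, fst z)) = (\<lambda>(x :: 'a, y :: 'b). (y, x))"
    by auto
  have m: "(\<lambda>z. (snd z, fst z)) \<in> measurable (lborel :: ('a \<times> 'b) measure) lborel"
    unfolding lborel_prod[symmetric] by measurable
  then show "(\<lambda>z. (snd z, fst z)) \<in> measurable (lebesgue :: ('a \<times> 'b) measure) lborel"
    by (rule measurable_completion)
  have "distr (lborel \<Otimes>\<^sub>M lborel :: ('a \<times> 'b) measure) (lborel \<Otimes>\<^sub>M lborel) (\<lambda>(x, y). (y, x))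
      = (lborel \<Otimes>\<^sub>M lborel :: ('b \<times> 'a) measure)"
    by (rule lborel_pair.distr_pair_swap[symmetric])
  then have "distr (lborel :: ('a \<times> 'b) measure) lborel (\<lambda>z. (snd z, fst z)) = lborel"
    unfolding swap by (simp add: lborel_prod)
  then have "distr (lebesgue :: ('a \<times> 'b) measure) lborel (\<lambda>z. (snd z, fst z)) = lborel"
    by (simp only: distr_completion[OF m])
  then show "null_sets lborel \<subseteq> null_sets (distr (lebesgue :: ('a \<times> 'b) measure) lborel (\<lambda>z. (snd z, fst z)))"
    by simp
qed

lemma nn_integral_lebesgue_commute:
  fixes f :: "'a::euclidean_space \<times> 'b::euclidean_space \<Rightarrow> ennreal"
  assumes [measurable]: "f \<in> borel_measurable lebesgue"
  shows "(\<integral>\<^sup>+x. \<integral>\<^sup>+y. f (x, y) \<partial>lebesgue \<partial>lebesgue) = (\<integral>\<^sup>+y. \<integral>\<^sup>+x. f (x, y) \<partial>lebesgue \<partial>lebesgue)"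
proof -
  have "(\<lambda>z. f (snd z, fst z)) \<in> borel_measurable lebesgue"
    by (rule measurable_compose[OF measurable_lebesgue_swap assms])
  from nn_integral_lebesgue_prod[OF this] show ?thesis
    by (simp add: nn_integral_lebesgue_prod assms nn_integral_lebesgue_prod_swap)
qed

text \<open>The bridge from the iterated integral in \<open>energy\<close> to one integral over the
  product. Sections of \<open>f\<close> are known to be measurable only for almost every
  \<open>x\<close>, so the outer integrand inherits its measurability from a Borel version.\<close>

lemma integral_lebesgue_prod:
  fixes f :: "'a::euclidean_space \<times> 'b::euclidean_space \<Rightarrow> real"
  assumes f: "integrable lebesgue f"
  shows "(LINT x|lebesgue. LINT y|lebesgue. f (x, y)) = integral\<^sup>L lebesgue f"
proof -
  have fm: "f \<in> borel_measurable lebesgue"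
    using f by auto
  obtain g where g: "g \<in> borel_measurable lborel" and ae: "AE z in lborel. f z = g z"
    using completion_ex_borel_measurable_real[OF fm] by auto
  have gm: "g \<in> borel_measurable lebesgue"
    using g by (rule measurable_completion)
  have "integrable lebesgue g"
    using f by (rule integrable_cong_AE_imp[OF _ gm]) (use ae in \<open>auto intro!: AE_completion\<close>)
  then have gi: "integrable (lborel \<Otimes>\<^sub>M lborel) g"
    using g by (simp add: integrable_completion lborel_prod)
  have sec: "(\<lambda>y. g (x, y)) \<in> borel_measurable lborel" for x
    using g by (simp add: lborel_prod[symmetric])
  have inner: "(LINT y|lebesgue. g (x, y)) = (LINT y|lborel. g (x, y))" for x
    using sec by (rule integral_completion)
  have "g \<in> borel_measurable (lborel \<Otimes>\<^sub>M lborel)"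
    using g by (simp add: lborel_prod)
  then have gint: "(\<lambda>x. LINT y|lborel. g (x, y)) \<in> borel_measurable lborel"
    by measurable
  have "AE x in lebesgue. AE y in lebesgue. g (x, y) = f (x, y)"
    using ae by (intro AE_lebesgue_prod AE_completion) auto
  then have eq: "AE x in lebesgue. (LINT y|lborel. g (x, y)) = (LINT y|lebesgue. f (x, y))"
  proof eventually_elim
    case (elim x)
    have "(\<lambda>y. f (x, y)) \<in> borel_measurable lebesgue"
      by (rule borel_measurable_AE[OF measurable_completion[OF sec] elim])
    with elim show ?case
      unfolding inner[symmetric] by (intro integral_cong_AE measurable_completion[OF sec]) auto
  qed
  have "(LINT x|lebesgue. LINT y|lebesgue. f (x, y)) = (LINT x|lebesgue. LINT y|lborel. g (x, y))"
    by (rule integral_cong_AE[OF borel_measurable_AE[OF measurable_completion[OF gint] eq]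
          measurable_completion[OF gint]]) (use eq in auto)
  also have "\<dots> = (LINT x|lborel. LINT y|lborel. g (x, y))"
    using gint by (rule integral_completion)
  also have "\<dots> = integral\<^sup>L (lborel \<Otimes>\<^sub>M lborel) g"
    using gi by (rule lborel_pair.integral_fst')
  also have "\<dots> = integral\<^sup>L lebesgue g"
    using g by (simp add: integral_completion lborel_prod)
  also have "\<dots> = integral\<^sup>L lebesgue f"
    by (rule integral_cong_AE[OF gm fm]) (use ae in \<open>auto intro!: AE_completion\<close>)
  finally show ?thesis .
qed

subsection \<open>Jump kernels\<close>

text \<open>Take the least i with (1/2)^(i+1) \<le> t: minimality gives t \<le> (1/2)^i when i > 0,
  and the cap 1 covers i = 0. The sum turns a truncated second moment into masses outside balls,
  which is what the decay estimate controls.\<close>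

lemma min_one_square_le_suminf:
  fixes t :: real
  assumes "0 \<le> t"
  shows "ennreal (min 1 (t\<^sup>2)) \<le> (\<Sum>i. ennreal ((1/4) ^ i) * indicator {(1/2) ^ Suc i..} t)"
proof (cases "t = 0")
  case False
  with assms have t: "0 < t" by simp
  then obtain m where "(1/2) ^ m < t"
    using real_arch_pow_inv[of t "1/2"] by auto
  then have ex: "\<exists>i. (1/2::real) ^ Suc i \<le> t"
    using power_decreasing[of m "Suc m" "1/2::real"] by (intro exI[of _ m]) linarith
  define i where "i = (LEAST i. (1/2::real) ^ Suc i \<le> t)"
  have i: "(1/2::real) ^ Suc i \<le> t"
    unfolding i_def using ex by (rule LeastI_ex)
  have "min 1 (t\<^sup>2) \<le> (1/4) ^ i"
  proof (cases i)
    case (Suc k)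
    then have "\<not> (1/2::real) ^ Suc k \<le> t"
      unfolding i_def by (intro not_less_Least) simp
    then have "t \<le> (1/2) ^ i" using Suc by simp
    then have "t\<^sup>2 \<le> ((1/2) ^ i)\<^sup>2"
      using t by (intro power_mono) auto
    also have "\<dots> = (1/4) ^ i"
      by (simp add: power2_eq_square flip: power_mult_distrib)
    finally show ?thesis by simp
  qed simp
  then have "ennreal (min 1 (t\<^sup>2)) \<le> ennreal ((1/4) ^ i) * indicator {(1/2) ^ Suc i..} t"
    using i by (simp add: ennreal_leI)
  also have "\<dots> \<le> (\<Sum>i. ennreal ((1/4) ^ i) * indicator {(1/2) ^ Suc i..} t)"
  proof -
    define f where "f i = ennreal ((1/4) ^ i) * indicator {(1/2) ^ Suc i..} t" for i
    show ?thesis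
      unfolding f_def[symmetric] using sum_le_suminf[of f "{i}"] by simp
  qed
  finally show ?thesis .
qed simp

text \<open>The dyadic layer i contributes 4^(-i) * C * 2^(\<alpha>(i+1)) = C * 2^\<alpha> *
  2^((\<alpha>-2)i); this is the sum of the geometric series, convergent since \<alpha> < 2.\<close>

definition truncation_const :: "real \<Rightarrow> real \<Rightarrow> real" where
  "truncation_const \<alpha> C = C * 2 powr \<alpha> / (1 - 2 powr (\<alpha> - 2))"

locale jump_kernel =
  fixes K :: "'a::euclidean_space \<Rightarrow> 'a \<Rightarrow> real" and \<alpha> C2 :: real
  assumes kernel: "symmetric_kernel K"
    and alpha: "0 < \<alpha>" "\<alpha> < 2"
    and C2_nonneg: "0 \<le> C2"
    and decay: "decay_estimate (kernel_measure K) \<alpha> C2"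
begin

abbreviation "\<mu> \<equiv> kernel_measure K"

lemma kernel_measurable [measurable]: "(\<lambda>z. K (fst z) (snd z)) \<in> borel_measurable lebesgue"
  using kernel by (simp add: symmetric_kernel_def case_prod_beta')

lemma kernel_section_measurable [measurable]: "K x \<in> borel_measurable lebesgue"
  using kernel by (simp add: symmetric_kernel_def)

lemma kernel_nonneg: "0 \<le> K x y"
  using kernel by (simp add: symmetric_kernel_def)

lemma kernel_sym: "K x y = K y x"
  using kernel by (simp add: symmetric_kernel_def)

lemma nn_integral_kernel:
  assumes "g \<in> borel_measurable lebesgue"
  shows "(\<integral>\<^sup>+y. g y \<partial>\<mu> x) = (\<integral>\<^sup>+y. g y * ennreal (K x y) \<partial>lebesgue)"
  using assms unfolding kernel_measure_def by (subst nn_integral_density) (auto simp: mult.commute)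

lemma emeasure_kernel:
  assumes "A \<in> sets lebesgue"
  shows "emeasure (\<mu> x) A = (\<integral>\<^sup>+y. indicator A y * ennreal (K x y) \<partial>lebesgue)"
  using assms unfolding kernel_measure_def by (subst emeasure_density) (auto simp: mult.commute)

text \<open>Energies and interaction terms become single integrals over the product, where symmetry
  of \<open>K\<close> is invariance under exchanging the two variables.\<close>

definition jint :: "('a \<times> 'a \<Rightarrow> ennreal) \<Rightarrow> ennreal" where
  "jint F = (\<integral>\<^sup>+z. F z * ennreal (K (fst z) (snd z)) \<partial>lebesgue)"

lemma jint_iterated:
  assumes [measurable]: "F \<in> borel_measurable lebesgue"
  shows "jint F = (\<integral>\<^sup>+x. \<integral>\<^sup>+y. F (x, y) * ennreal (K x y) \<partial>lebesgue \<partial>lebesgue)"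
proof -
  have "(\<lambda>z. F z * ennreal (K (fst z) (snd z))) \<in> borel_measurable lebesgue"
    by measurable
  from nn_integral_lebesgue_prod[OF this] show ?thesis
    by (simp add: jint_def)
qed

lemma jint_mono: "(\<And>z. F z \<le> G z) \<Longrightarrow> jint F \<le> jint G"
  unfolding jint_def by (intro nn_integral_mono mult_right_mono) auto

lemma jint_add:
  assumes [measurable]: "F \<in> borel_measurable lebesgue" "G \<in> borel_measurable lebesgue"
  shows "jint (\<lambda>z. F z + G z) = jint F + jint G"
  unfolding jint_def by (subst nn_integral_add[symmetric]) (auto simp: distrib_right)

lemma jint_cmult:
  assumes [measurable]: "F \<in> borel_measurable lebesgue"
  shows "jint (\<lambda>z. c * F z) = c * jint F"
  unfolding jint_def by (subst nn_integral_cmult[symmetric]) (auto simp: mult.assoc)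

lemma jint_swap:
  assumes [measurable]: "F \<in> borel_measurable lebesgue"
  shows "jint (\<lambda>z. F (snd z, fst z)) = jint F"
proof -
  have "(\<lambda>z. F z * ennreal (K (fst z) (snd z))) \<in> borel_measurable lebesgue"
    by measurable
  from nn_integral_lebesgue_prod_swap[OF this] show ?thesis
    unfolding jint_def by (simp add: kernel_sym)
qed

text \<open>The bound \<open>c\<close> is required only where \<open>f\<close> does not vanish,
  because tails of \<open>u\<close> are controlled only from points of a smaller ball.\<close>

lemma jint_le_nn_integral:
  assumes [measurable]: "f \<in> borel_measurable lebesgue" "F \<in> borel_measurable lebesgue"
      "\<And>x. (\<lambda>y. F (x, y)) \<in> borel_measurable lebesgue"
    and c: "\<And>x. f x \<noteq> 0 \<Longrightarrow> (\<integral>\<^sup>+y. F (x, y) * ennreal (K x y) \<partial>lebesgue) \<le> c"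
  shows "jint (\<lambda>z. f (fst z) * F z) \<le> c * integral\<^sup>N lebesgue f"
proof -
  have "jint (\<lambda>z. f (fst z) * F z)
      = (\<integral>\<^sup>+x. \<integral>\<^sup>+y. f x * (F (x, y) * ennreal (K x y)) \<partial>lebesgue \<partial>lebesgue)"
    by (subst jint_iterated) (auto simp: mult.assoc)
  also have "\<dots> = (\<integral>\<^sup>+x. f x * (\<integral>\<^sup>+y. F (x, y) * ennreal (K x y) \<partial>lebesgue) \<partial>lebesgue)"
    by (intro nn_integral_cong nn_integral_cmult) measurable
  also have "\<dots> \<le> (\<integral>\<^sup>+x. c * f x \<partial>lebesgue)"
  proof (intro nn_integral_mono)
    fix x
    show "f x * (\<integral>\<^sup>+y. F (x, y) * ennreal (K x y) \<partial>lebesgue) \<le> c * f x"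
      using mult_left_mono[OF c[of x], of "f x"] by (cases "f x = 0") (auto simp: mult.commute[of c])
  qed
  also have "\<dots> = c * integral\<^sup>N lebesgue f"
    by (rule nn_integral_cmult) measurable
  finally show ?thesis .
qed

lemma indicator_times_measurable [measurable]:
  assumes [measurable]: "D \<in> sets (lebesgue :: 'a measure)" "D' \<in> sets (lebesgue :: 'a measure)"
  shows "(indicator (D \<times> D') :: _ \<Rightarrow> ennreal) \<in> borel_measurable lebesgue"
proof -
  have "indicator (D \<times> D') = (\<lambda>z. indicator D (fst z) * indicator D' (snd z) :: ennreal)"
    by (auto simp: fun_eq_iff split: split_indicator)
  then show ?thesis by simp
qed

lemma energy_sq_eq_jint:
  assumes [measurable]: "u \<in> borel_measurable lebesgue" "D \<in> sets lebesgue"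
  shows "energy_sq \<mu> D u = jint (\<lambda>z. ennreal ((u (snd z) - u (fst z))\<^sup>2) * indicator (D \<times> D) z)"
proof -
  have "energy_sq \<mu> D u = (\<integral>\<^sup>+x. (\<integral>\<^sup>+y. ennreal ((u y - u x)\<^sup>2) * indicator (D \<times> D) (x, y) * ennreal (K x y) \<partial>lebesgue) \<partial>lebesgue)"
    unfolding energy_sq_def
    by (intro nn_integral_cong, subst nn_integral_kernel)
       (auto simp: indicator_times split: split_indicator)
  then show ?thesis
    by (subst jint_iterated) auto
qed

abbreviation "C3 \<equiv> truncation_const \<alpha> C2"

lemma C3_nonneg: "0 \<le> C3"
proof -
  have "2 powr (\<alpha> - 2) < 2 powr (0::real)"
    using alpha by (intro powr_less_mono) auto
  then show ?thesis
    using C2_nonneg by (auto simp: truncation_const_def)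
qed

text \<open>The kernel's second moment below the scale 1/L and its mass beyond that scale are both
  of order L^\<alpha>. Each follows from the decay estimate alone after summing over dyadic
  layers.\<close>

lemma nn_integral_truncated_square_le:
  assumes L: "0 < L"
  shows "(\<integral>\<^sup>+y. ennreal (min 1 ((L * norm (x - y))\<^sup>2)) * ennreal (K x y) \<partial>lebesgue) \<le> ennreal (C3 * L powr \<alpha>)"
proof -
  let ?B = "\<lambda>i::nat. - ball x ((1/2) ^ Suc i / L)"
  define q :: real where "q = 2 powr (\<alpha> - 2)"
  have q: "0 < q" "q < 1"
    using alpha powr_less_mono[of "\<alpha> - 2" 0 2] unfolding q_def by auto
  have [measurable]: "?B i \<in> sets lebesgue" for i
    by (intro sets_completionI_sets) simp
  have meas: "(\<lambda>y. indicator (?B i) y * ennreal (K x y)) \<in> borel_measurable lebesgue" for i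
    by measurable
  have B: "indicator {(1/2) ^ Suc i..} (L * norm (x - y)) = (indicator (?B i) y :: ennreal)" for i y
    using L by (auto simp: indicator_def dist_norm field_simps)
  have "(\<integral>\<^sup>+y. ennreal (min 1 ((L * norm (x - y))\<^sup>2)) * ennreal (K x y) \<partial>lebesgue)
      \<le> (\<integral>\<^sup>+y. (\<Sum>i. ennreal ((1/4) ^ i) * (indicator (?B i) y * ennreal (K x y))) \<partial>lebesgue)"
  proof (rule nn_integral_mono)
    fix y
    have "ennreal (min 1 ((L * norm (x - y))\<^sup>2)) * ennreal (K x y)
        \<le> (\<Sum>i. ennreal ((1/4) ^ i) * indicator {(1/2) ^ Suc i..} (L * norm (x - y))) * ennreal (K x y)"
      using L by (intro mult_right_mono min_one_square_le_suminf) auto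
    also have "\<dots> = (\<Sum>i. ennreal ((1/4) ^ i) * indicator (?B i) y * ennreal (K x y))"
      unfolding B by (rule ennreal_suminf_multc[symmetric])
    finally show "ennreal (min 1 ((L * norm (x - y))\<^sup>2)) * ennreal (K x y)
        \<le> (\<Sum>i. ennreal ((1/4) ^ i) * (indicator (?B i) y * ennreal (K x y)))"
      by (simp add: mult.assoc)
  qed
  also have "\<dots> = (\<Sum>i. \<integral>\<^sup>+y. ennreal ((1/4) ^ i) * (indicator (?B i) y * ennreal (K x y)) \<partial>lebesgue)"
    by (intro nn_integral_suminf borel_measurable_times_ennreal borel_measurable_const meas)
  also have "\<dots> = (\<Sum>i. ennreal ((1/4) ^ i) * emeasure (\<mu> x) (?B i))"
    by (intro suminf_cong, subst nn_integral_cmult[OF meas], subst emeasure_kernel) (rule \<open>?B _ \<in> _\<close>, rule refl)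
  also have "\<dots> \<le> (\<Sum>i. ennreal (C2 * 2 powr \<alpha> * L powr \<alpha> * q ^ i))"
  proof (rule suminf_le)
    fix i
    have "emeasure (\<mu> x) (?B i) \<le> ennreal (C2 * ((1/2) ^ Suc i / L) powr - \<alpha>)"
      using decay L unfolding decay_estimate_def by (auto simp del: power_Suc)
    then have "ennreal ((1/4) ^ i) * emeasure (\<mu> x) (?B i) \<le> ennreal ((1/4) ^ i * (C2 * ((1/2) ^ Suc i / L) powr - \<alpha>))"
      by (subst ennreal_mult') (auto intro: mult_left_mono)
    also have "(1/4) ^ i * (C2 * ((1/2) ^ Suc i / L) powr - \<alpha>) = C2 * 2 powr \<alpha> * L powr \<alpha> * q ^ i"
    proof -
      have half: "(1/2::real) ^ m = 2 powr (- real m)" for m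
        by (simp add: powr_minus powr_realpow power_one_over inverse_eq_divide)
      have "(1/4::real) ^ i = (1/2) ^ i * (1/2) ^ i"
        by (simp flip: power_mult_distrib)
      then have quarter: "(1/4::real) ^ i = 2 powr (- 2 * i)"
        unfolding half by (simp flip: powr_add)
      have ratio: "q ^ i = 2 powr ((\<alpha> - 2) * i)"
        unfolding q_def by (simp add: powr_powr flip: powr_realpow)
      have scale: "((1/2) ^ Suc i / L) powr - \<alpha> = 2 powr (\<alpha> + \<alpha> * i) * L powr \<alpha>"
      proof -
        have "(2 powr - real (Suc i) / L) powr - \<alpha> = 2 powr (\<alpha> + \<alpha> * i) / L powr - \<alpha>"
          using L by (simp add: powr_divide powr_powr algebra_simps)
        then show ?thesis
          unfolding half using L by (simp add: powr_minus[of L] divide_inverse)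
      qed
      have "2 powr (- 2 * i) * 2 powr (\<alpha> + \<alpha> * i) = 2 powr \<alpha> * 2 powr ((\<alpha> - 2) * i)"
        by (simp add: algebra_simps flip: powr_add)
      then show ?thesis
        unfolding quarter ratio scale by (simp add: mult_ac)
    qed
    finally show "ennreal ((1/4) ^ i) * emeasure (\<mu> x) (?B i) \<le> ennreal (C2 * 2 powr \<alpha> * L powr \<alpha> * q ^ i)" .
  qed auto
  also have "\<dots> = ennreal (\<Sum>i. C2 * 2 powr \<alpha> * L powr \<alpha> * q ^ i)"
    using q C2_nonneg by (intro suminf_ennreal2 summable_mult summable_geometric) auto
  also have "(\<Sum>i. C2 * 2 powr \<alpha> * L powr \<alpha> * q ^ i) = C3 * L powr \<alpha>"
    using q by (subst suminf_mult) (auto simp: suminf_geometric truncation_const_def q_def summable_geometric)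
  finally show ?thesis .
qed

end

subsection \<open>Cutoffs and energy spaces\<close>

lemma ball_lebesgue [measurable]: "ball x r \<in> sets lebesgue" "- ball x r \<in> sets lebesgue"
  for x :: "'a::euclidean_space"
  by (auto intro!: sets_completionI_sets)

lemma L2_on_UNIV_I:
  assumes "u \<in> borel_measurable lebesgue" "(\<integral>\<^sup>+x. ennreal ((u x)\<^sup>2) \<partial>lebesgue) < \<infinity>"
  shows "u \<in> L2_on UNIV"
  using assms by (auto simp: L2_on_def lebesgue_on_UNIV_eq intro!: integrableI_nonneg)

lemma L2_on_nn_integral_finite:
  assumes "u \<in> L2_on D" "D \<in> sets lebesgue"
  shows "(\<integral>\<^sup>+x. ennreal ((u x)\<^sup>2) * indicator D x \<partial>lebesgue) < \<infinity>"
  using assms unfolding L2_on_def by (simp add: integrable_iff_bounded nn_integral_restrict_space)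

lemma measurable_lebesgue_norm_diff [measurable]:
  "(\<lambda>z :: 'a::euclidean_space \<times> 'a. norm (fst z - snd z)) \<in> borel_measurable lebesgue"
  by (intro measurable_completion) (simp add: borel_measurable_continuous_onI continuous_intros)

lemma measurable_lebesgue_norm_diff_const [measurable]:
  "(\<lambda>y :: 'a::euclidean_space. norm (x - y)) \<in> borel_measurable lebesgue"
  by (intro measurable_completion) (simp add: borel_measurable_continuous_onI continuous_intros)

text \<open>Inside \<open>B \<times> B\<close> this is the product rule. If only one point lies in
  \<open>B\<close>, the cutoff vanishes at the other, so the value of \<open>w\<close> outside
  \<open>B\<close> never enters.\<close>

lemma lipschitz_cutoff_mult_diff_le:
  fixes \<eta> w :: "'a::real_normed_vector \<Rightarrow> real"
  assumes \<eta>: "\<And>x. 0 \<le> \<eta> x" "\<And>x. \<eta> x \<le> 1" "\<And>x y. \<bar>\<eta> x - \<eta> y\<bar> \<le> L * norm (x - y)" "\<And>x. \<eta> x \<noteq> 0 \<Longrightarrow> x \<in> B"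
  shows "(\<eta> y * w y - \<eta> x * w x)\<^sup>2 \<le> 2 * ((w y - w x)\<^sup>2 * indicator (B \<times> B) (x, y))
    + 2 * ((w x)\<^sup>2 * indicator B x * min 1 ((L * norm (x - y))\<^sup>2))
    + 2 * ((w y)\<^sup>2 * indicator B y * min 1 ((L * norm (x - y))\<^sup>2))"
proof -
  define t where "t = min 1 ((L * norm (x - y))\<^sup>2)"
  have "(\<eta> y - \<eta> x)\<^sup>2 \<le> 1\<^sup>2"
    using \<eta>(1,2)[of x] \<eta>(1,2)[of y] by (intro power2_le_iff_abs_le[THEN iffD2]) auto
  moreover have "\<bar>\<eta> y - \<eta> x\<bar>\<^sup>2 \<le> (L * norm (x - y))\<^sup>2"
    using \<eta>(3)[of x y] by (intro power_mono) auto
  ultimately have t: "(\<eta> y - \<eta> x)\<^sup>2 \<le> t" "0 \<le> t"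
    by (auto simp: t_def)
  have one: "(\<eta> y)\<^sup>2 \<le> 1"
    using \<eta>(1,2)[of y] by (simp add: power_le_one)
  have "(\<eta> y * w y - \<eta> x * w x)\<^sup>2 \<le> 2 * ((w y - w x)\<^sup>2 * indicator (B \<times> B) (x, y))
    + 2 * ((w x)\<^sup>2 * indicator B x * t) + 2 * ((w y)\<^sup>2 * indicator B y * t)"
  proof (cases "x \<in> B"; cases "y \<in> B")
    assume B: "x \<in> B" "y \<in> B"
    have "(\<eta> y * w y - \<eta> x * w x)\<^sup>2 = (\<eta> y * (w y - w x) + w x * (\<eta> y - \<eta> x))\<^sup>2"
      by (simp add: algebra_simps)
    also have "\<dots> \<le> 2 * (\<eta> y * (w y - w x))\<^sup>2 + 2 * (w x * (\<eta> y - \<eta> x))\<^sup>2"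
      by (smt (verit) sum_squares_bound power2_sum)
    also have "\<dots> \<le> 2 * (1 * (w y - w x)\<^sup>2) + 2 * ((w x)\<^sup>2 * t)"
      unfolding power_mult_distrib using t one by (intro add_mono mult_left_mono mult_right_mono) auto
    finally show ?thesis
      using B t by (simp add: indicator_def) (smt (verit) mult_nonneg_nonneg zero_le_power2)
  next
    assume B: "x \<in> B" "y \<notin> B"
    then have "\<eta> y = 0" using \<eta>(4) by blast
    then have "(\<eta> y * w y - \<eta> x * w x)\<^sup>2 = (w x)\<^sup>2 * (\<eta> y - \<eta> x)\<^sup>2"
      by (simp add: power_mult_distrib)
    also have "\<dots> \<le> (w x)\<^sup>2 * t"
      using t by (intro mult_left_mono) auto
    finally show ?thesis
      using B t by (simp add: indicator_def) (smt (verit) mult_nonneg_nonneg zero_le_power2)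
  next
    assume B: "x \<notin> B" "y \<in> B"
    then have "\<eta> x = 0" using \<eta>(4) by blast
    then have "(\<eta> y * w y - \<eta> x * w x)\<^sup>2 = (w y)\<^sup>2 * (\<eta> y - \<eta> x)\<^sup>2"
      by (simp add: power_mult_distrib)
    also have "\<dots> \<le> (w y)\<^sup>2 * t"
      using t by (intro mult_left_mono) auto
    finally show ?thesis
      using B t by (simp add: indicator_def) (smt (verit) mult_nonneg_nonneg zero_le_power2)
  next
    assume "x \<notin> B" "y \<notin> B"
    then have "\<eta> x = 0" "\<eta> y = 0" using \<eta>(4) by blast+
    then show ?thesis using t by (auto simp: indicator_def)
  qed
  then show ?thesis by (simp add: t_def)
qed

context jump_kernel
begin

lemma jint_truncated_square_fst_le:
  assumes [measurable]: "f \<in> borel_measurable lebesgue" and L: "0 < L"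
  shows "jint (\<lambda>z. f (fst z) * ennreal (min 1 ((L * norm (fst z - snd z))\<^sup>2)))
    \<le> ennreal (C3 * L powr \<alpha>) * integral\<^sup>N lebesgue f"
proof -
  have "jint (\<lambda>z. f (fst z) * (\<lambda>z. ennreal (min 1 ((L * norm (fst z - snd z))\<^sup>2))) z)
    \<le> ennreal (C3 * L powr \<alpha>) * integral\<^sup>N lebesgue f"
    by (rule jint_le_nn_integral) (use nn_integral_truncated_square_le[OF L] in \<open>auto simp: mult.commute\<close>)
  then show ?thesis by simp
qed

lemma jint_truncated_square_snd_le:
  assumes [measurable]: "f \<in> borel_measurable lebesgue" and L: "0 < L"
  shows "jint (\<lambda>z. f (snd z) * ennreal (min 1 ((L * norm (fst z - snd z))\<^sup>2)))
    \<le> ennreal (C3 * L powr \<alpha>) * integral\<^sup>N lebesgue f"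
  using jint_truncated_square_fst_le[OF assms]
    jint_swap[of "\<lambda>z. f (fst z) * ennreal (min 1 ((L * norm (fst z - snd z))\<^sup>2))"]
  by (simp add: norm_minus_commute)

text \<open>Interactions of \<open>B\<close> with the whole space cost only the square integral of
  \<open>w\<close> over \<open>B\<close>, since the truncated second moment of the kernel is bounded
  uniformly in the base point.\<close>

lemma energy_cutoff_mult_finite:
  fixes w \<eta> :: "'a \<Rightarrow> real"
  assumes [measurable]: "w \<in> borel_measurable lebesgue" "\<eta> \<in> borel_measurable lebesgue" "B \<in> sets lebesgue"
    and \<eta>: "\<And>x. 0 \<le> \<eta> x" "\<And>x. \<eta> x \<le> 1" "\<And>x y. \<bar>\<eta> x - \<eta> y\<bar> \<le> L * norm (x - y)" "\<And>x. \<eta> x \<noteq> 0 \<Longrightarrow> x \<in> B"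
    and L: "0 < L"
    and fin: "(\<integral>\<^sup>+x. ennreal ((w x)\<^sup>2) * indicator B x \<partial>lebesgue) < \<infinity>" "energy_sq \<mu> B w < \<infinity>"
  shows "(\<lambda>x. \<eta> x * w x) \<in> H_space \<mu>"
proof -
  let ?t = "\<lambda>z. ennreal (min 1 ((L * norm (fst z - snd z))\<^sup>2))"
  let ?W = "\<lambda>x. ennreal ((w x)\<^sup>2) * indicator B x"
  let ?A = "\<lambda>z. ennreal ((w (snd z) - w (fst z))\<^sup>2) * indicator (B \<times> B) z"
  have "energy_sq \<mu> UNIV (\<lambda>x. \<eta> x * w x) = jint (\<lambda>z. ennreal ((\<eta> (snd z) * w (snd z) - \<eta> (fst z) * w (fst z))\<^sup>2))"
    by (subst energy_sq_eq_jint) auto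
  also have "\<dots> \<le> jint (\<lambda>z. 2 * ?A z + 2 * (?W (fst z) * ?t z) + 2 * (?W (snd z) * ?t z))"
  proof (rule jint_mono)
    fix z
    have "ennreal ((\<eta> (snd z) * w (snd z) - \<eta> (fst z) * w (fst z))\<^sup>2) \<le> ennreal (
      2 * ((w (snd z) - w (fst z))\<^sup>2 * indicator (B \<times> B) (fst z, snd z))
    + 2 * ((w (fst z))\<^sup>2 * indicator B (fst z) * min 1 ((L * norm (fst z - snd z))\<^sup>2))
    + 2 * ((w (snd z))\<^sup>2 * indicator B (snd z) * min 1 ((L * norm (fst z - snd z))\<^sup>2)))"
      by (intro ennreal_leI lipschitz_cutoff_mult_diff_le \<eta>)
    also have "\<dots> = 2 * ?A z + 2 * (?W (fst z) * ?t z) + 2 * (?W (snd z) * ?t z)"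
      by (simp add: ennreal_mult ennreal_indicator)
    finally show "ennreal ((\<eta> (snd z) * w (snd z) - \<eta> (fst z) * w (fst z))\<^sup>2)
      \<le> 2 * ?A z + 2 * (?W (fst z) * ?t z) + 2 * (?W (snd z) * ?t z)" .
  qed
  also have "\<dots> = 2 * jint ?A + 2 * jint (\<lambda>z. ?W (fst z) * ?t z) + 2 * jint (\<lambda>z. ?W (snd z) * ?t z)"
    by (simp add: jint_add jint_cmult)
  also have "\<dots> \<le> 2 * energy_sq \<mu> B w + 2 * (ennreal (C3 * L powr \<alpha>) * integral\<^sup>N lebesgue ?W)
      + 2 * (ennreal (C3 * L powr \<alpha>) * integral\<^sup>N lebesgue ?W)"
    using L by (intro add_mono mult_left_mono jint_truncated_square_fst_le jint_truncated_square_snd_le)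
      (auto simp: energy_sq_eq_jint)
  also have "\<dots> < \<infinity>"
    using fin by (auto simp: ennreal_mult_less_top)
  finally have "energy_sq \<mu> UNIV (\<lambda>x. \<eta> x * w x) < \<infinity>" .
  moreover have "(\<integral>\<^sup>+x. ennreal ((\<eta> x * w x)\<^sup>2) \<partial>lebesgue) \<le> integral\<^sup>N lebesgue ?W"
  proof (rule nn_integral_mono)
    fix x
    have "(\<eta> x)\<^sup>2 * (w x)\<^sup>2 \<le> 1 * (w x)\<^sup>2"
      using \<eta>(1,2)[of x] by (intro mult_right_mono) (auto simp: power_le_one)
    then show "ennreal ((\<eta> x * w x)\<^sup>2) \<le> ?W x"
      using \<eta>(4)[of x] by (auto simp: indicator_def power_mult_distrib ennreal_leI)
  qed
  ultimately show ?thesis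
    using fin by (auto simp: H_space_def intro!: L2_on_UNIV_I)
qed

text \<open>Makes the Poincare inequality, stated for \<open>H_loc\<close>, available for cut-off
  truncations.\<close>

lemma H_space_subset_H_loc:
  assumes "v \<in> H_space \<mu>"
  shows "v \<in> H_loc \<mu> E"
  unfolding H_loc_def mem_Collect_eq
proof (intro allI impI conjI)
  fix D :: "'a set" assume D: "open D"
  then have [measurable]: "D \<in> sets lebesgue" by auto
  have v [measurable]: "v \<in> borel_measurable lebesgue" and i: "integrable lebesgue (\<lambda>x. (v x)\<^sup>2)"
    using assms by (auto simp: H_space_def L2_on_def lebesgue_on_UNIV_eq)
  have "integrable (lebesgue_on D) (\<lambda>x. (v x)\<^sup>2)"
    using integrable_mult_indicator[OF \<open>D \<in> sets lebesgue\<close> i] by (simp add: integrable_restrict_space)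
  then show "v \<in> L2_on D"
    by (auto simp: L2_on_def intro: measurable_restrict_space1)
  have "energy_sq \<mu> D v \<le> energy_sq \<mu> UNIV v"
    by (simp add: energy_sq_eq_jint) (auto intro!: jint_mono simp: indicator_def)
  then show "energy_sq \<mu> D v < \<infinity>"
    using assms by (auto simp: H_space_def)
qed

end

subsection \<open>The Caccioppoli inequality\<close>

text \<open>
  For the truncations themselves this is the identity \<open>(pa - qb)\<^sup>2 = (a - b)(p\<^sup>2a - q\<^sup>2b) + ab(p - q)\<^sup>2\<close>; it makes the
  energy estimate free of absorption arguments.
\<close>

lemma truncation_test_ineq:
  fixes a b k p q :: real
  defines "a' \<equiv> max (a - k) 0" and "b' \<equiv> max (b - k) 0"
  shows "(p * a' - q * b')\<^sup>2 \<le> (a - b) * (p\<^sup>2 * a' - q\<^sup>2 * b') + b' * a' * (q - p)\<^sup>2"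
proof -
  have "(p * a' - q * b')\<^sup>2 = (a' - b') * (p\<^sup>2 * a' - q\<^sup>2 * b') + b' * a' * (q - p)\<^sup>2"
    by (simp add: power2_eq_square algebra_simps)
  \<comment> \<open>If both values exceed \<open>k\<close>, truncation preserves their difference;
    if neither does, both sides vanish. If exactly one does, raising the other to \<open>k\<close>
    only shortens a difference that has the same sign as the test difference.\<close>
  moreover have "(a' - b') * (p\<^sup>2 * a' - q\<^sup>2 * b') \<le> (a - b) * (p\<^sup>2 * a' - q\<^sup>2 * b')"
  proof (cases "a \<le> k"; cases "b \<le> k")
    assume *: "a \<le> k" "\<not> b \<le> k"
    then have "0 \<le> q\<^sup>2 * (b - k)" by simp
    then have "(b - k) * (q\<^sup>2 * (b - k)) \<le> (b - a) * (q\<^sup>2 * (b - k))"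
      using * by (intro mult_right_mono) auto
    then show ?thesis
      using * by (simp add: a'_def b'_def max_def algebra_simps)
  next
    assume *: "\<not> a \<le> k" "b \<le> k"
    then have "0 \<le> p\<^sup>2 * (a - k)" by simp
    then have "(a - k) * (p\<^sup>2 * (a - k)) \<le> (a - b) * (p\<^sup>2 * (a - k))"
      using * by (intro mult_right_mono) auto
    then show ?thesis
      using * by (simp add: a'_def b'_def max_def)
  qed (auto simp: a'_def b'_def max_def)
  ultimately show ?thesis by simp
qed

locale subsolution_setup = jump_kernel K \<alpha> C2
  for K :: "'a::euclidean_space \<Rightarrow> 'a \<Rightarrow> real" and \<alpha> C2 :: real +
  fixes E :: "'a set" and u :: "'a \<Rightarrow> real" and x0 :: 'a and r R :: real
  assumes sub: "local_weak_subsolution \<mu> E u"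
    and ball_E: "ball x0 R \<subseteq> E"
    and r: "0 < r" "r < R"
begin

abbreviation "B \<equiv> ball x0 r"

lemma u_measurable [measurable]: "u \<in> borel_measurable lebesgue"
  using sub by (simp add: local_weak_subsolution_def)

lemma u_local: "u \<in> L2_on B" "energy_sq \<mu> B u < \<infinity>"
proof -
  have "cball x0 r \<subseteq> ball x0 R" using r by auto
  then have "closure B \<subseteq> E" using r ball_E by auto
  then show "u \<in> L2_on B" "energy_sq \<mu> B u < \<infinity>"
    using sub by (auto simp: local_weak_subsolution_def H_loc_def)
qed

lemma u_square_finite: "(\<integral>\<^sup>+x. ennreal ((u x)\<^sup>2) * indicator B x \<partial>lebesgue) < \<infinity>"
  using u_local(1) by (rule L2_on_nn_integral_finite) measurable

text \<open>The tail condition is applied to \<open>B\<close> itself, so the uniform bound reaches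
  only up to radius 7/8 * r. Test functions are therefore supported in a ball of radius \<sigma>
  \<le> 7/8 * r.\<close>

lemma tail_finite: "\<exists>S < \<infinity>. \<forall>x\<in>ball x0 (7 / 8 * r). (\<integral>\<^sup>+y. ennreal \<bar>u y\<bar> * indicator (- B) y * ennreal (K x y) \<partial>lebesgue) \<le> S"
proof -
  let ?S = "SUP x\<in>ball x0 (7 / 8 * r). \<integral>\<^sup>+y\<in>- B. ennreal \<bar>u y\<bar> \<partial>\<mu> x"
  have "ball x0 r \<subseteq> E" using ball_E r by auto
  then have "?S < \<infinity>"
    using sub r by (auto simp: local_weak_subsolution_def)
  moreover have "(\<integral>\<^sup>+y. ennreal \<bar>u y\<bar> * indicator (- B) y * ennreal (K x y) \<partial>lebesgue) \<le> ?S"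
    if "x \<in> ball x0 (7 / 8 * r)" for x
    by (subst nn_integral_kernel[symmetric]) (measurable, rule SUP_upper[OF that])
  ultimately show ?thesis by blast
qed

section \<open>Test functions, absolute convergence of the form, and the energy estimate\<close>

context
  fixes k L \<sigma> :: real and \<zeta> :: "'a \<Rightarrow> real"
  assumes k: "0 \<le> k" and L: "0 < L" and \<sigma>: "0 < \<sigma>" "\<sigma> \<le> 7 / 8 * r"
    and \<zeta>m [measurable]: "\<zeta> \<in> borel_measurable lebesgue"
    and \<zeta>: "\<And>x. 0 \<le> \<zeta> x" "\<And>x. \<zeta> x \<le> 1" "\<And>x y. \<bar>\<zeta> x - \<zeta> y\<bar> \<le> L * norm (x - y)"
      "\<And>x. \<zeta> x \<noteq> 0 \<Longrightarrow> x \<in> ball x0 \<sigma>"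
begin

abbreviation "w \<equiv> \<lambda>x. max (u x - k) 0"
text \<open>The cutoff is squared to match the factors \<open>p\<^sup>2\<close> and
  \<open>q\<^sup>2\<close> in \<open>truncation_test_ineq\<close>.\<close>

abbreviation "\<phi> \<equiv> \<lambda>x. (\<zeta> x)\<^sup>2 * w x"

lemma truncation_local: "(\<integral>\<^sup>+x. ennreal ((w x)\<^sup>2) * indicator B x \<partial>lebesgue) < \<infinity>" "energy_sq \<mu> B w < \<infinity>"
proof -
  have "(w x)\<^sup>2 \<le> (u x)\<^sup>2" for x
    using k by (intro abs_le_square_iff[THEN iffD1]) auto
  then have "(\<integral>\<^sup>+x. ennreal ((w x)\<^sup>2) * indicator B x \<partial>lebesgue) \<le> (\<integral>\<^sup>+x. ennreal ((u x)\<^sup>2) * indicator B x \<partial>lebesgue)"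
    by (intro nn_integral_mono mult_right_mono ennreal_leI) auto
  then show "(\<integral>\<^sup>+x. ennreal ((w x)\<^sup>2) * indicator B x \<partial>lebesgue) < \<infinity>"
    using u_square_finite by (rule le_less_trans)
  have "(w y - w x)\<^sup>2 \<le> (u y - u x)\<^sup>2" for x y
    by (intro abs_le_square_iff[THEN iffD1]) auto
  then have "energy_sq \<mu> B w \<le> energy_sq \<mu> B u"
    by (simp add: energy_sq_eq_jint) (intro jint_mono mult_right_mono ennreal_leI, auto)
  then show "energy_sq \<mu> B w < \<infinity>"
    using u_local(2) by (rule le_less_trans)
qed

lemma support_in_B: "x \<in> ball x0 \<sigma> \<Longrightarrow> x \<in> B"
  using \<sigma> r by auto

lemma test_function_in_H_space: "\<phi> \<in> H_space \<mu>"
proof (rule energy_cutoff_mult_finite[where B = B and L = "2 * L"])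
  show "\<bar>(\<zeta> x)\<^sup>2 - (\<zeta> y)\<^sup>2\<bar> \<le> 2 * L * norm (x - y)" for x y
  proof -
    have "\<bar>(\<zeta> x)\<^sup>2 - (\<zeta> y)\<^sup>2\<bar> = \<bar>\<zeta> x + \<zeta> y\<bar> * \<bar>\<zeta> x - \<zeta> y\<bar>"
      by (simp add: power2_eq_square square_diff_square_factored abs_mult)
    also have "\<dots> \<le> 2 * (L * norm (x - y))"
      using \<zeta>(1,2)[of x] \<zeta>(1,2)[of y] by (intro mult_mono \<zeta>(3)) auto
    finally show ?thesis by simp
  qed
qed (use \<zeta> L truncation_local support_in_B in \<open>auto simp: power_le_one\<close>)

lemma cutoff_mult_in_H_space: "(\<lambda>x. \<zeta> x * w x) \<in> H_space \<mu>"
  by (rule energy_cutoff_mult_finite[where B = B and L = L])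
    (use \<zeta> L truncation_local support_in_B in auto)

lemma energy_test_le: "energy \<mu> UNIV u \<phi> \<le> 0"
proof -
  have "{x. \<phi> x \<noteq> 0} \<subseteq> ball x0 \<sigma>"
    using \<zeta>(4) by auto
  then have "closure {x. \<phi> x \<noteq> 0} \<subseteq> cball x0 \<sigma>"
    by (intro closure_minimal) auto
  also have "\<dots> \<subseteq> E"
    using \<sigma> r ball_E by (auto simp: subset_iff)
  finally show ?thesis
    using sub test_function_in_H_space by (auto simp: local_weak_subsolution_def)
qed

abbreviation "F \<equiv> \<lambda>z. (u (snd z) - u (fst z)) * (\<phi> (snd z) - \<phi> (fst z))"

text \<open>Each summand on the right has finite integral against the kernel. In
  \<open>B \<times> B\<close> Young's inequality suffices. Across the boundary of \<open>B\<close>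
  no energy of \<open>u\<close> is available, but there the two points are a fixed distance apart
  whenever \<phi> is non-zero at one of them.\<close>

lemma integrand_abs_le:
  fixes x y :: 'a
  defines "t \<equiv> min 1 ((8 / r * norm (x - y))\<^sup>2)"
  shows "\<bar>F (x, y)\<bar> \<le> (u y - u x)\<^sup>2 * indicator (B \<times> B) (x, y) + (\<phi> y - \<phi> x)\<^sup>2
    + (u x)\<^sup>2 * indicator B x * t + (u y)\<^sup>2 * indicator B y * t
    + \<phi> x * (\<bar>u y\<bar> * indicator (- B) y) + \<phi> y * (\<bar>u x\<bar> * indicator (- B) x)"
proof -
  have \<phi>0: "0 \<le> \<phi> x" for x
    by (intro mult_nonneg_nonneg) auto
  have \<phi>u: "\<phi> x \<le> \<bar>u x\<bar>" for x
  proof -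
    have "\<phi> x \<le> 1 * w x"
      using \<zeta>(1,2)[of x] by (intro mult_right_mono) (auto simp: power_le_one)
    then show ?thesis using k by auto
  qed
  have t0: "0 \<le> t" by (simp add: t_def)
  have far: "\<bar>u y' - u x'\<bar> * \<phi> x' \<le> (u x')\<^sup>2 * t + \<phi> x' * \<bar>u y'\<bar>"
    if "x' \<in> B" "y' \<notin> B" "norm (x' - y') = norm (x - y)" for x' y'
  proof (cases "\<phi> x' = 0")
    case False
    then have "dist x0 x' < \<sigma>" using \<zeta>(4)[of x'] by auto
    moreover have "r \<le> dist x0 y'" using that by auto
    moreover have "dist x0 y' \<le> dist x0 x' + norm (x' - y')"
      by (metis dist_norm dist_triangle)
    \<comment> \<open>The gap between the radii 7/8 * r and r is r/8, so the weight \<open>t\<close>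
      with slope 8/r reaches its cap 1.\<close>
    ultimately have "1 \<le> 8 / r * norm (x - y)"
      using \<sigma> r that(3) by (simp add: field_simps)
    then have t1: "t = 1"
      by (simp add: t_def)
    have "\<bar>u y' - u x'\<bar> * \<phi> x' \<le> (\<bar>u y'\<bar> + \<bar>u x'\<bar>) * \<phi> x'"
      using \<phi>0 by (intro mult_right_mono) auto
    also have "\<dots> \<le> \<phi> x' * \<bar>u y'\<bar> + \<bar>u x'\<bar> * \<bar>u x'\<bar>"
      using mult_left_mono[OF \<phi>u[of x'], of "\<bar>u x'\<bar>"] by (simp add: algebra_simps)
    finally show ?thesis by (simp add: t1 power2_eq_square)
  next
    case True
    show ?thesis unfolding True by (simp add: t0)
  qed
  have nn: "0 \<le> (u x)\<^sup>2 * t" "0 \<le> (u y)\<^sup>2 * t" "0 \<le> (\<phi> y - \<phi> x)\<^sup>2" "0 \<le> \<phi> x * \<bar>u y\<bar>" "0 \<le> \<phi> y * \<bar>u x\<bar>"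
    using t0 \<phi>0 by (auto intro!: mult_nonneg_nonneg)
  have out: "\<phi> x = 0" if "x \<notin> B" for x
    using \<zeta>(4) support_in_B that by fastforce
  show ?thesis
  proof (cases "x \<in> B"; cases "y \<in> B")
    assume B: "x \<in> B" "y \<in> B"
    have "2 * (\<bar>u y - u x\<bar> * \<bar>\<phi> y - \<phi> x\<bar>) \<le> \<bar>u y - u x\<bar>\<^sup>2 + \<bar>\<phi> y - \<phi> x\<bar>\<^sup>2"
      using sum_squares_bound[of "\<bar>u y - u x\<bar>" "\<bar>\<phi> y - \<phi> x\<bar>"] by (simp only: mult.assoc)
    then have "\<bar>F (x, y)\<bar> \<le> (u y - u x)\<^sup>2 + (\<phi> y - \<phi> x)\<^sup>2"
      unfolding fst_conv snd_conv abs_mult power2_abs using mult_nonneg_nonneg[of "\<bar>u y - u x\<bar>" "\<bar>\<phi> y - \<phi> x\<bar>"] by linarith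
    then show ?thesis using B nn by simp
  next
    assume B: "x \<in> B" "y \<notin> B"
    have "\<bar>F (x, y)\<bar> = \<bar>u y - u x\<bar> * \<phi> x"
      unfolding fst_conv snd_conv using out[OF B(2)] \<phi>0[of x] by (simp only: abs_mult) simp
    then show ?thesis using far[of x y] B nn(1,2) by (simp add: add.assoc add_increasing)
  next
    assume B: "x \<notin> B" "y \<in> B"
    have "\<bar>F (x, y)\<bar> = \<bar>u x - u y\<bar> * \<phi> y"
      unfolding fst_conv snd_conv out[OF B(1)] diff_zero abs_mult[of _ "\<phi> y"] abs_of_nonneg[OF \<phi>0[of y]]
      by (simp only: abs_minus_commute)
    then show ?thesis using far[of y x] B nn(1,2) by (simp add: norm_minus_commute add.assoc add_increasing)
  next
    assume B: "x \<notin> B" "y \<notin> B"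
    show ?thesis
      unfolding fst_conv snd_conv out[OF B(1)] out[OF B(2)] using B by simp
  qed
qed


text \<open>A Bochner integral is 0 by default when its integrand is not integrable, so the
  inequality for \<open>energy\<close> yields an estimate only after absolute convergence over the
  product is known.\<close>

lemma integrand_integrable: "integrable lebesgue (\<lambda>z. F z * K (fst z) (snd z))"
proof -
  let ?t = "\<lambda>z. ennreal (min 1 ((8 / r * norm (fst z - snd z))\<^sup>2))"
  let ?U = "\<lambda>x. ennreal ((u x)\<^sup>2) * indicator B x"
  let ?A = "\<lambda>z. ennreal ((u (snd z) - u (fst z))\<^sup>2) * indicator (B \<times> B) z"
  let ?P = "\<lambda>z. ennreal ((\<phi> (snd z) - \<phi> (fst z))\<^sup>2)"
  let ?V = "\<lambda>y. ennreal \<bar>u y\<bar> * indicator (- B) y"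
  have \<phi>0: "0 \<le> \<phi> x" for x
    by (intro mult_nonneg_nonneg) auto
  obtain S where S: "S < \<infinity>" "\<And>x. x \<in> ball x0 (7 / 8 * r) \<Longrightarrow> (\<integral>\<^sup>+y. ?V y * ennreal (K x y) \<partial>lebesgue) \<le> S"
    using tail_finite by blast
  have tail: "jint (\<lambda>z. ennreal (\<phi> (fst z)) * ?V (snd z)) \<le> S * (\<integral>\<^sup>+x. ennreal (\<phi> x) \<partial>lebesgue)"
  proof -
    have "jint (\<lambda>z. ennreal (\<phi> (fst z)) * (\<lambda>z. ?V (snd z)) z) \<le> S * (\<integral>\<^sup>+x. ennreal (\<phi> x) \<partial>lebesgue)"
    proof (rule jint_le_nn_integral)
      fix x assume "ennreal (\<phi> x) \<noteq> 0"
      then have "x \<in> ball x0 \<sigma>" using \<zeta>(4)[of x] by auto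
      then have "x \<in> ball x0 (7 / 8 * r)" using \<sigma> by auto
      from S(2)[OF this] show "(\<integral>\<^sup>+y. ?V (snd (x, y)) * ennreal (K x y) \<partial>lebesgue) \<le> S"
        by simp
    qed auto
    then show ?thesis by simp
  qed
  have tail': "jint (\<lambda>z. ennreal (\<phi> (snd z)) * ?V (fst z)) \<le> S * (\<integral>\<^sup>+x. ennreal (\<phi> x) \<partial>lebesgue)"
    using tail jint_swap[of "\<lambda>z. ennreal (\<phi> (fst z)) * ?V (snd z)"] by simp
  \<comment> \<open>The tail terms need \<phi> in L^1, while \<open>u\<close> is only in L^2 on
    \<open>B\<close>; on a set of finite measure \<phi> \<le> 1 + u^2 is enough.\<close>
  have "(\<integral>\<^sup>+x. ennreal (\<phi> x) \<partial>lebesgue) \<le> (\<integral>\<^sup>+x. indicator B x + ?U x \<partial>lebesgue)"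
  proof (rule nn_integral_mono)
    fix x
    show "ennreal (\<phi> x) \<le> indicator B x + ?U x"
    proof (cases "x \<in> B")
      case True
      have "\<phi> x \<le> 1 * w x"
        using \<zeta>(1,2)[of x] by (intro mult_right_mono) (auto simp: power_le_one)
      also have "\<dots> \<le> 1 + (u x)\<^sup>2"
        using k sum_squares_bound[of 1 "u x"] by (auto simp: max_def)
      finally have "ennreal (\<phi> x) \<le> ennreal (1 + (u x)\<^sup>2)"
        by (rule ennreal_leI)
      with True show ?thesis by simp
    next
      case False
      then show ?thesis using \<zeta>(4)[of x] support_in_B by fastforce
    qed
  qed
  also have "\<dots> = emeasure lebesgue B + integral\<^sup>N lebesgue ?U"
    by (subst nn_integral_add) auto
  also have "\<dots> < \<infinity>"
    using u_square_finite emeasure_lborel_ball_finite[of x0 r] by simp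
  finally have \<phi>_int: "(\<integral>\<^sup>+x. ennreal (\<phi> x) \<partial>lebesgue) < \<infinity>" .
  have "jint (\<lambda>z. ennreal \<bar>F z\<bar>) \<le> jint (\<lambda>z. ?A z + ?P z + ?U (fst z) * ?t z + ?U (snd z) * ?t z
      + ennreal (\<phi> (fst z)) * ?V (snd z) + ennreal (\<phi> (snd z)) * ?V (fst z))"
  proof (rule jint_mono)
    fix z
    note integrand_abs_le[of "fst z" "snd z", THEN ennreal_leI]
    also have "ennreal ((u (snd z) - u (fst z))\<^sup>2 * indicator (B \<times> B) (fst z, snd z) + (\<phi> (snd z) - \<phi> (fst z))\<^sup>2
      + (u (fst z))\<^sup>2 * indicator B (fst z) * min 1 ((8 / r * norm (fst z - snd z))\<^sup>2)
      + (u (snd z))\<^sup>2 * indicator B (snd z) * min 1 ((8 / r * norm (fst z - snd z))\<^sup>2)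
      + \<phi> (fst z) * (\<bar>u (snd z)\<bar> * indicator (- B) (snd z)) + \<phi> (snd z) * (\<bar>u (fst z)\<bar> * indicator (- B) (fst z)))
      = ?A z + ?P z + ?U (fst z) * ?t z + ?U (snd z) * ?t z
      + ennreal (\<phi> (fst z)) * ?V (snd z) + ennreal (\<phi> (snd z)) * ?V (fst z)"
      using \<phi>0[of "fst z"] \<phi>0[of "snd z"] by (simp add: ennreal_mult ennreal_indicator)
    finally show "ennreal \<bar>F z\<bar> \<le> ?A z + ?P z + ?U (fst z) * ?t z + ?U (snd z) * ?t z
      + ennreal (\<phi> (fst z)) * ?V (snd z) + ennreal (\<phi> (snd z)) * ?V (fst z)" by simp
  qed
  also have "\<dots> = jint ?A + jint ?P + jint (\<lambda>z. ?U (fst z) * ?t z) + jint (\<lambda>z. ?U (snd z) * ?t z)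
      + jint (\<lambda>z. ennreal (\<phi> (fst z)) * ?V (snd z)) + jint (\<lambda>z. ennreal (\<phi> (snd z)) * ?V (fst z))"
    by (simp add: jint_add)
  also have "\<dots> \<le> energy_sq \<mu> B u + energy_sq \<mu> UNIV \<phi>
      + ennreal (C3 * (8 / r) powr \<alpha>) * integral\<^sup>N lebesgue ?U + ennreal (C3 * (8 / r) powr \<alpha>) * integral\<^sup>N lebesgue ?U
      + S * (\<integral>\<^sup>+x. ennreal (\<phi> x) \<partial>lebesgue) + S * (\<integral>\<^sup>+x. ennreal (\<phi> x) \<partial>lebesgue)"
    using r by (intro add_mono tail tail' jint_truncated_square_fst_le jint_truncated_square_snd_le)
      (auto simp: energy_sq_eq_jint)
  also have "\<dots> < \<infinity>"
    using S(1) \<phi>_int u_local u_square_finite test_function_in_H_space by (auto simp: ennreal_mult_less_top H_space_def)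
  finally have "jint (\<lambda>z. ennreal \<bar>F z\<bar>) < \<infinity>" .
  then have "(\<integral>\<^sup>+z. ennreal (norm (F z * K (fst z) (snd z))) \<partial>lebesgue) < \<infinity>"
    unfolding jint_def by (simp add: abs_mult ennreal_mult kernel_nonneg)
  then show ?thesis
    by (intro integrableI_bounded) measurable
qed

lemma integrand_integral_le: "(LINT z|lebesgue. F z * K (fst z) (snd z)) \<le> 0"
proof -
  have "(LINT y|\<mu> x. F (x, y)) = (LINT y|lebesgue. F (x, y) * K x y)" for x
    unfolding kernel_measure_def by (subst integral_density) (auto simp: kernel_nonneg mult.commute)
  then have "energy \<mu> UNIV u \<phi> = (LINT x|lebesgue. LINT y|lebesgue. F (x, y) * K x y)"
    by (simp add: energy_def set_lebesgue_integral_def)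
  also have "\<dots> = (LINT z|lebesgue. F z * K (fst z) (snd z))"
    using integral_lebesgue_prod[OF integrand_integrable] by simp
  finally show ?thesis using energy_test_le by simp
qed

text \<open>\<open>truncation_test_ineq\<close> is integrated against the kernel, and the integral
  of the part \<open>F\<close> is at most 0 by the sub-solution property. If the right-hand side is
  finite, both parts are integrable and the real integrals may be added.\<close>

lemma caccioppoli:
  "energy_sq \<mu> UNIV (\<lambda>x. \<zeta> x * w x)
    \<le> jint (\<lambda>z. ennreal (w (fst z) * w (snd z) * (\<zeta> (fst z) - \<zeta> (snd z))\<^sup>2))"
proof -
  let ?K = "\<lambda>z. K (fst z) (snd z)"
  let ?G = "\<lambda>z. w (fst z) * w (snd z) * (\<zeta> (fst z) - \<zeta> (snd z))\<^sup>2"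
  let ?P = "\<lambda>z. (\<zeta> (snd z) * w (snd z) - \<zeta> (fst z) * w (fst z))\<^sup>2"
  have G0: "0 \<le> ?G z" for z by auto
  have PFG: "?P z \<le> F z + ?G z" for z
    by (rule truncation_test_ineq)
  have K0: "0 \<le> ?K z" for z by (rule kernel_nonneg)
  have P: "energy_sq \<mu> UNIV (\<lambda>x. \<zeta> x * w x) = jint (\<lambda>z. ennreal (?P z))"
    by (subst energy_sq_eq_jint) auto
  show ?thesis
  proof (cases "jint (\<lambda>z. ennreal (?G z)) = \<infinity>")
    case False
    have jG: "jint (\<lambda>z. ennreal (?G z)) = (\<integral>\<^sup>+z. ennreal (?G z * ?K z) \<partial>lebesgue)"
      unfolding jint_def using G0 K0 by (intro nn_integral_cong) (simp add: ennreal_mult)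
    then have Gi: "integrable lebesgue (\<lambda>z. ?G z * ?K z)"
      using False G0 K0 by (intro integrableI_nonneg) (auto simp: top.not_eq_extremum)
    have i: "integrable lebesgue (\<lambda>z. F z * ?K z + ?G z * ?K z)"
      using integrand_integrable Gi by (rule Bochner_Integration.integrable_add)
    have le: "?P z * ?K z \<le> F z * ?K z + ?G z * ?K z" for z
      using mult_right_mono[OF PFG K0] by (simp add: distrib_right)
    have "jint (\<lambda>z. ennreal (?P z)) = (\<integral>\<^sup>+z. ennreal (?P z * ?K z) \<partial>lebesgue)"
      unfolding jint_def using K0 by (intro nn_integral_cong) (simp add: ennreal_mult)
    also have "\<dots> \<le> (\<integral>\<^sup>+z. ennreal (F z * ?K z + ?G z * ?K z) \<partial>lebesgue)"
      by (intro nn_integral_mono ennreal_leI le)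
    also have "\<dots> = ennreal (LINT z|lebesgue. F z * ?K z + ?G z * ?K z)"
      using i by (rule nn_integral_eq_integral)
        (use le K0 in \<open>auto intro!: AE_I2 order_trans[OF _ le] mult_nonneg_nonneg\<close>)
    also have "\<dots> \<le> ennreal (LINT z|lebesgue. ?G z * ?K z)"
      using integrand_integral_le integrand_integrable Gi by (intro ennreal_leI) (subst Bochner_Integration.integral_add, auto)
    also have "\<dots> = jint (\<lambda>z. ennreal (?G z))"
      unfolding jG using Gi by (rule nn_integral_eq_integral[symmetric]) (use G0 K0 in auto)
    finally show ?thesis unfolding P .
  qed simp
qed

text \<open>For pairs inside \<open>ball x0 \<rho>\<close>, Young's inequality for w(x) w(y) and the
  Lipschitz bound give the first term. For a pair leaving that ball the cutoff difference is only
  bounded by 1, and w(x) meets the tail \<open>M\<close>; the two orders of such a pair give the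
  factor 2.\<close>

lemma energy_truncation_le:
  assumes \<rho>: "\<sigma> \<le> \<rho>"
    and M: "\<And>x. x \<in> ball x0 \<sigma> \<Longrightarrow>
      (\<integral>\<^sup>+y. ennreal (w y) * indicator (- ball x0 \<rho>) y * ennreal (K x y) \<partial>lebesgue) \<le> M"
  shows "energy_sq \<mu> UNIV (\<lambda>x. \<zeta> x * w x)
    \<le> ennreal (C3 * L powr \<alpha>) * (\<integral>\<^sup>+x. ennreal ((w x)\<^sup>2) * indicator (ball x0 \<rho>) x \<partial>lebesgue)
      + 2 * M * (\<integral>\<^sup>+x. ennreal (w x) * indicator (ball x0 \<rho>) x \<partial>lebesgue)"
proof -
  let ?B = "ball x0 \<rho>"
  let ?G = "\<lambda>z. w (fst z) * w (snd z) * (\<zeta> (fst z) - \<zeta> (snd z))\<^sup>2"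
  let ?t = "\<lambda>z. ennreal (min 1 ((L * norm (fst z - snd z))\<^sup>2))"
  let ?W = "\<lambda>x. ennreal ((w x)\<^sup>2 / 2) * indicator ?B x"
  let ?f = "\<lambda>x. ennreal (w x) * indicator (ball x0 \<sigma>) x"
  let ?V = "\<lambda>y. ennreal (w y) * indicator (- ?B) y"
  have tail: "jint (\<lambda>z. ?f (fst z) * ?V (snd z)) \<le> M * integral\<^sup>N lebesgue ?f"
  proof -
    have "jint (\<lambda>z. ?f (fst z) * (\<lambda>z. ?V (snd z)) z) \<le> M * integral\<^sup>N lebesgue ?f"
    proof (rule jint_le_nn_integral)
      fix x assume "?f x \<noteq> 0"
      then have "x \<in> ball x0 \<sigma>" by (auto split: split_indicator_asm)
      from M[OF this] show "(\<integral>\<^sup>+y. ?V (snd (x, y)) * ennreal (K x y) \<partial>lebesgue) \<le> M"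
        by simp
    qed auto
    then show ?thesis by simp
  qed
  have tail': "jint (\<lambda>z. ?f (snd z) * ?V (fst z)) \<le> M * integral\<^sup>N lebesgue ?f"
    using tail jint_swap[of "\<lambda>z. ?f (fst z) * ?V (snd z)"] by simp
  have half: "integral\<^sup>N lebesgue ?W + integral\<^sup>N lebesgue ?W = (\<integral>\<^sup>+x. ennreal ((w x)\<^sup>2) * indicator ?B x \<partial>lebesgue)"
    by (subst nn_integral_add[symmetric]) (auto intro!: nn_integral_cong split: split_indicator simp flip: ennreal_plus)
  have f: "integral\<^sup>N lebesgue ?f \<le> (\<integral>\<^sup>+x. ennreal (w x) * indicator ?B x \<partial>lebesgue)"
    using \<rho> by (intro nn_integral_mono) (auto simp: indicator_def)
  have "jint (\<lambda>z. ennreal (?G z)) \<le> jint (\<lambda>z. ?W (fst z) * ?t z + ?W (snd z) * ?t z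
      + ?f (fst z) * ?V (snd z) + ?f (snd z) * ?V (fst z))"
  proof (rule jint_mono)
    fix z :: "'a \<times> 'a"
    obtain x y where z: "z = (x, y)" by (cases z)
    define t where "t = min 1 ((L * norm (x - y))\<^sup>2)"
    have out: "\<zeta> x = 0" if "x \<notin> ?B" for x
      using \<zeta>(4) \<rho> that by fastforce
    have "(\<zeta> x - \<zeta> y)\<^sup>2 \<le> 1\<^sup>2"
      using \<zeta>(1,2)[of x] \<zeta>(1,2)[of y] by (intro power2_le_iff_abs_le[THEN iffD2]) auto
    moreover have "\<bar>\<zeta> x - \<zeta> y\<bar>\<^sup>2 \<le> (L * norm (x - y))\<^sup>2"
      using \<zeta>(3)[of x y] by (intro power_mono) auto
    ultimately have t: "(\<zeta> x - \<zeta> y)\<^sup>2 \<le> t" "0 \<le> t" "(\<zeta> x - \<zeta> y)\<^sup>2 \<le> 1"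
      by (auto simp: t_def)
    \<comment> \<open>As \<zeta> vanishes at \<open>y\<close>, the product survives only if \<zeta>
      does not vanish at \<open>x\<close>; this puts \<open>x\<close> in the smaller ball, where
      \<open>M\<close> is a valid bound.\<close>
    have far: "ennreal (w x * w y * (\<zeta> x - \<zeta> y)\<^sup>2) \<le> ?f x * ?V y" if "x \<in> ?B" "y \<notin> ?B" for x y
    proof (cases "\<zeta> x = 0")
      case False
      then have x: "x \<in> ball x0 \<sigma>" by (rule \<zeta>(4))
      have "(\<zeta> x - \<zeta> y)\<^sup>2 \<le> 1\<^sup>2"
        using \<zeta>(1,2)[of x] \<zeta>(1,2)[of y] by (intro power2_le_iff_abs_le[THEN iffD2]) auto
      then have "w x * w y * (\<zeta> x - \<zeta> y)\<^sup>2 \<le> w x * w y * 1"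
        by (intro mult_left_mono) auto
      then have "ennreal (w x * w y * (\<zeta> x - \<zeta> y)\<^sup>2) \<le> ennreal (w x * w y)"
        by (intro ennreal_leI) simp
      also have "\<dots> = ?f x * ?V y"
        using x that by (simp add: ennreal_mult)
      finally show ?thesis .
    next
      case True
      then show ?thesis using out[OF that(2)] by simp
    qed
    show "ennreal (?G z) \<le> ?W (fst z) * ?t z + ?W (snd z) * ?t z
      + ?f (fst z) * ?V (snd z) + ?f (snd z) * ?V (fst z)"
    proof (cases "x \<in> ?B"; cases "y \<in> ?B")
      assume B: "x \<in> ?B" "y \<in> ?B"
      have "w x * w y * (\<zeta> x - \<zeta> y)\<^sup>2 \<le> ((w x)\<^sup>2 / 2 + (w y)\<^sup>2 / 2) * t"
        using sum_squares_bound[of "w x" "w y"] t by (intro mult_mono) auto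
      then have "ennreal (w x * w y * (\<zeta> x - \<zeta> y)\<^sup>2) \<le> ennreal ((w x)\<^sup>2 / 2 * t + (w y)\<^sup>2 / 2 * t)"
        by (intro ennreal_leI) (simp add: distrib_right)
      also have "\<dots> = ?W (fst z) * ?t z + ?W (snd z) * ?t z"
        using B t by (simp add: z ennreal_mult t_def[symmetric] del: times_divide_eq_left)
      finally show ?thesis using B by (simp add: z)
    next
      assume B: "x \<in> ?B" "y \<notin> ?B"
      show ?thesis
        using far[OF B] by (simp add: z add_increasing add_increasing2)
    next
      assume B: "x \<notin> ?B" "y \<in> ?B"
      show ?thesis
        using far[OF B(2,1)] by (simp add: z add_increasing power2_commute mult.commute[of "w x"])
    next
      assume "x \<notin> ?B" "y \<notin> ?B"
      then show ?thesis using out by (simp add: z)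
    qed
  qed
  also have "\<dots> = jint (\<lambda>z. ?W (fst z) * ?t z) + jint (\<lambda>z. ?W (snd z) * ?t z)
      + jint (\<lambda>z. ?f (fst z) * ?V (snd z)) + jint (\<lambda>z. ?f (snd z) * ?V (fst z))"
    by (simp add: jint_add)
  also have "\<dots> \<le> ennreal (C3 * L powr \<alpha>) * integral\<^sup>N lebesgue ?W + ennreal (C3 * L powr \<alpha>) * integral\<^sup>N lebesgue ?W
      + M * integral\<^sup>N lebesgue ?f + M * integral\<^sup>N lebesgue ?f"
    using L by (intro add_mono tail tail' jint_truncated_square_fst_le jint_truncated_square_snd_le) auto
  also have "\<dots> = ennreal (C3 * L powr \<alpha>) * (\<integral>\<^sup>+x. ennreal ((w x)\<^sup>2) * indicator ?B x \<partial>lebesgue)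
      + 2 * M * integral\<^sup>N lebesgue ?f"
    unfolding half[symmetric] by (simp add: distrib_left mult_2 distrib_right add.assoc)
  also have "\<dots> \<le> ennreal (C3 * L powr \<alpha>) * (\<integral>\<^sup>+x. ennreal ((w x)\<^sup>2) * indicator ?B x \<partial>lebesgue)
      + 2 * M * (\<integral>\<^sup>+x. ennreal (w x) * indicator ?B x \<partial>lebesgue)"
    by (intro add_left_mono mult_left_mono f) auto
  finally show ?thesis
    by (rule order_trans[OF caccioppoli])
qed

end

end

subsection \<open>The Faber--Krahn inequality and the pointwise kernel bound\<close>

lemma emeasure_lebesgue_ball:
  fixes x :: "'a::euclidean_space"
  assumes "0 \<le> s"
  shows "emeasure lebesgue (ball x s) = ennreal (unit_ball_vol (real DIM('a)) * s ^ DIM('a))"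
  using assms by (simp add: emeasure_ball)

text \<open>
  On the zero set of \<open>v\<close>, which fills at least half of the ball, the deviation from \<open>m\<close> is \<open>m\<^sup>2\<close>.
  So \<open>m\<close> is controlled by the deviation, without any integrability of \<open>v\<close>.
\<close>

lemma nn_integral_square_le_deviation:
  fixes v :: "'a::euclidean_space \<Rightarrow> real" and m :: real
  assumes [measurable]: "v \<in> borel_measurable lebesgue" and "0 < s"
    and small: "2 * emeasure lebesgue {x. v x \<noteq> 0} \<le> emeasure lebesgue (ball z s)"
  shows "(\<integral>\<^sup>+x\<in>ball z s. ennreal ((v x)\<^sup>2) \<partial>lebesgue) \<le> 6 * (\<integral>\<^sup>+x\<in>ball z s. ennreal ((v x - m)\<^sup>2) \<partial>lebesgue)"
proof -
  let ?B = "ball z s"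
  let ?I = "\<integral>\<^sup>+x\<in>?B. ennreal ((v x - m)\<^sup>2) \<partial>lebesgue"
  let ?Z = "{x. v x = 0} \<inter> ?B"
  have "{x \<in> space lebesgue. v x \<noteq> 0} \<in> sets lebesgue" "{x \<in> space lebesgue. v x = 0} \<in> sets lebesgue"
    by measurable
  then have [measurable]: "{x. v x \<noteq> 0} \<in> sets lebesgue" "{x. v x = 0} \<in> sets lebesgue"
    by simp_all
  have fin: "emeasure lebesgue ?B < \<infinity>"
    using \<open>0 < s\<close> by (simp add: emeasure_lebesgue_ball del: emeasure_completion)
  have Z: "emeasure lebesgue ?B \<le> 2 * emeasure lebesgue ?Z"
  proof -
    let ?N = "emeasure lebesgue ({x. v x \<noteq> 0} \<inter> ?B)"
    have "emeasure lebesgue (?Z \<union> ({x. v x \<noteq> 0} \<inter> ?B)) = emeasure lebesgue ?Z + ?N"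
      by (rule plus_emeasure[symmetric]) auto
    moreover have "?Z \<union> ({x. v x \<noteq> 0} \<inter> ?B) = ?B" by auto
    ultimately have split: "emeasure lebesgue ?B = emeasure lebesgue ?Z + ?N" by simp
    have "?N \<le> emeasure lebesgue {x. v x \<noteq> 0}"
      by (rule emeasure_mono) auto
    then have "2 * ?N \<le> 2 * emeasure lebesgue {x. v x \<noteq> 0}"
      by (rule mult_left_mono) simp
    with small have "2 * ?N \<le> emeasure lebesgue ?Z + ?N"
      unfolding split by (rule order_trans[rotated])
    moreover have "?N \<noteq> \<infinity>"
      using fin unfolding split by (auto simp del: emeasure_completion)
    ultimately have "?N \<le> emeasure lebesgue ?Z"
      by (simp add: mult_2 add.commute ennreal_add_left_cancel_le del: emeasure_completion)
    then show ?thesis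
      unfolding split mult_2 by (rule add_left_mono)
  qed
  have "ennreal (m\<^sup>2) * emeasure lebesgue ?Z = (\<integral>\<^sup>+x. ennreal (m\<^sup>2) * indicator ?Z x \<partial>lebesgue)"
    by (subst nn_integral_cmult_indicator) auto
  also have "\<dots> \<le> ?I"
    by (intro nn_integral_mono) (auto simp: indicator_def)
  finally have mZ: "ennreal (m\<^sup>2) * emeasure lebesgue ?Z \<le> ?I" .
  have "(\<integral>\<^sup>+x\<in>?B. ennreal ((v x)\<^sup>2) \<partial>lebesgue)
      \<le> (\<integral>\<^sup>+x. 2 * (ennreal ((v x - m)\<^sup>2) * indicator ?B x) + 2 * (ennreal (m\<^sup>2) * indicator ?B x) \<partial>lebesgue)"
  proof (intro nn_integral_mono)
    fix x
    have "(v x)\<^sup>2 = ((v x - m) + m)\<^sup>2" by simp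
    also have "\<dots> \<le> 2 * (v x - m)\<^sup>2 + 2 * m\<^sup>2"
      using sum_squares_bound[of "v x - m" m] unfolding power2_sum by linarith
    finally have "ennreal ((v x)\<^sup>2) \<le> ennreal (2 * (v x - m)\<^sup>2 + 2 * m\<^sup>2)"
      by (rule ennreal_leI)
    then show "ennreal ((v x)\<^sup>2) * indicator ?B x
      \<le> 2 * (ennreal ((v x - m)\<^sup>2) * indicator ?B x) + 2 * (ennreal (m\<^sup>2) * indicator ?B x)"
      by (auto simp: indicator_def ennreal_mult)
  qed
  also have "\<dots> = 2 * ?I + 2 * (ennreal (m\<^sup>2) * emeasure lebesgue ?B)"
    by (simp add: nn_integral_add nn_integral_cmult nn_integral_cmult_indicator del: emeasure_completion)
  \<comment> \<open>The zero set carries at least half of the ball, so m^2 times the full measure is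
    at most 2 * \<open>?I\<close>; this gives 6 = 2 + 2 * 2.\<close>
  also have "\<dots> \<le> 2 * ?I + 2 * (2 * ?I)"
  proof (intro add_left_mono mult_left_mono)
    have "ennreal (m\<^sup>2) * emeasure lebesgue ?B \<le> ennreal (m\<^sup>2) * (2 * emeasure lebesgue ?Z)"
      using Z by (rule mult_left_mono) simp
    also have "\<dots> \<le> 2 * ?I"
      using mult_left_mono[OF mZ, of 2] by (simp add: mult.left_commute del: emeasure_completion)
    finally show "ennreal (m\<^sup>2) * emeasure lebesgue ?B \<le> 2 * ?I" .
  qed simp
  also have "\<dots> = 6 * ?I"
    by (simp flip: mult.assoc distrib_right)
  finally show ?thesis .
qed

context jump_kernel
begin

text \<open>A pair of points is seen by exactly those centres \<open>z\<close> within distance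
  \<open>s\<close> of both, a set of measure at most that of one ball. Keeping \<open>c\<close>
  inside the integrand avoids asking for measurability of the ball energy in
  \<open>z\<close>.\<close>

lemma energy_sq_ball_nn_integral_le:
  assumes [measurable]: "v \<in> borel_measurable lebesgue" and s: "0 < s"
  shows "(\<integral>\<^sup>+z. c * energy_sq \<mu> (ball z s) v \<partial>lebesgue) \<le> c * (emeasure lebesgue (ball (0::'a) s) * energy_sq \<mu> UNIV v)"
proof -
  let ?h = "\<lambda>p. c * (ennreal ((v (snd p) - v (fst p))\<^sup>2) * ennreal (K (fst p) (snd p)))"
  let ?i = "\<lambda>z p. indicator (ball (fst p) s) z * indicator (ball (snd p) s) z :: ennreal"
  let ?S = "{q :: 'a \<times> 'a \<times> 'a. dist (fst (snd q)) (fst q) < s \<and> dist (snd (snd q)) (fst q) < s}"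
  have "open ?S"
    by (intro open_Collect_conj open_Collect_less continuous_intros)
  then have [measurable]: "?S \<in> sets lebesgue" by auto
  have "(\<lambda>q. ?h (snd q)) \<in> borel_measurable (lebesgue :: ('a \<times> 'a \<times> 'a) measure)"
    by (rule measurable_compose[OF measurable_lebesgue_snd]) measurable
  then have "(\<lambda>q. ?h (snd q) * indicator ?S q) \<in> borel_measurable (lebesgue :: ('a \<times> 'a \<times> 'a) measure)"
    by measurable
  moreover have "(\<lambda>q. ?h (snd q) * indicator ?S q) = (\<lambda>q. ?h (snd q) * ?i (fst q) (snd q))"
    by (auto simp: fun_eq_iff indicator_def)
  ultimately have m: "(\<lambda>q. ?h (snd q) * ?i (fst q) (snd q)) \<in> borel_measurable (lebesgue :: ('a \<times> 'a \<times> 'a) measure)"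
    by simp
  have "(\<integral>\<^sup>+z. c * energy_sq \<mu> (ball z s) v \<partial>lebesgue) = (\<integral>\<^sup>+z. \<integral>\<^sup>+p. ?h p * ?i z p \<partial>lebesgue \<partial>lebesgue)"
    unfolding energy_sq_eq_jint[OF assms(1) ball_lebesgue(1)] jint_def
    by (subst nn_integral_cmult[symmetric], measurable)
      (auto intro!: nn_integral_cong simp: indicator_def dist_commute)
  also have "\<dots> = (\<integral>\<^sup>+p. \<integral>\<^sup>+z. ?h p * ?i z p \<partial>lebesgue \<partial>lebesgue)"
    using nn_integral_lebesgue_commute[OF m] by simp
  also have "\<dots> \<le> (\<integral>\<^sup>+p. emeasure lebesgue (ball (0::'a) s) * ?h p \<partial>lebesgue)"
  proof (intro nn_integral_mono)
    fix p :: "'a \<times> 'a"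
    have "(\<integral>\<^sup>+z. ?h p * ?i z p \<partial>lebesgue) \<le> (\<integral>\<^sup>+z. ?h p * indicator (ball (fst p) s) z \<partial>lebesgue)"
      by (intro nn_integral_mono mult_left_mono) (auto simp: indicator_def)
    also have "\<dots> = ?h p * emeasure lebesgue (ball (fst p) s)"
      by (rule nn_integral_cmult_indicator) measurable
    also have "emeasure lebesgue (ball (fst p) s) = emeasure lebesgue (ball (0::'a) s)"
      using s by (simp add: emeasure_lebesgue_ball del: emeasure_completion)
    finally show "(\<integral>\<^sup>+z. ?h p * ?i z p \<partial>lebesgue) \<le> emeasure lebesgue (ball (0::'a) s) * ?h p"
      by (simp only: mult.commute)
  qed
  also have "\<dots> = c * (emeasure lebesgue (ball (0::'a) s) * energy_sq \<mu> UNIV v)"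
    by (simp add: nn_integral_cmult energy_sq_eq_jint jint_def mult.left_commute del: emeasure_completion)
  finally show ?thesis .
qed

lemma nn_integral_ball_average:
  fixes f :: "'a \<Rightarrow> ennreal"
  assumes [measurable]: "f \<in> borel_measurable lebesgue" and s: "0 < s"
  shows "(\<integral>\<^sup>+z. (\<integral>\<^sup>+x\<in>ball z s. f x \<partial>lebesgue) \<partial>lebesgue) = emeasure lebesgue (ball (0::'a) s) * integral\<^sup>N lebesgue f"
proof -
  let ?S = "{q :: 'a \<times> 'a. dist (fst q) (snd q) < s}"
  have "open ?S"
    by (intro open_Collect_less continuous_intros)
  then have [measurable]: "?S \<in> sets lebesgue" by auto
  have "(\<lambda>q. f (snd q) * indicator ?S q) \<in> borel_measurable lebesgue"
    by measurable
  moreover have "(\<lambda>q. f (snd q) * indicator ?S q) = (\<lambda>q. f (snd q) * indicator (ball (snd q) s) (fst q))"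
    by (auto simp: fun_eq_iff indicator_def dist_commute)
  ultimately have m: "(\<lambda>q. f (snd q) * indicator (ball (snd q) s) (fst q)) \<in> borel_measurable lebesgue"
    by simp
  have "(\<integral>\<^sup>+z. (\<integral>\<^sup>+x\<in>ball z s. f x \<partial>lebesgue) \<partial>lebesgue) = (\<integral>\<^sup>+z. (\<integral>\<^sup>+x. f x * indicator (ball x s) z \<partial>lebesgue) \<partial>lebesgue)"
    by (intro nn_integral_cong) (auto simp: indicator_def dist_commute)
  also have "\<dots> = (\<integral>\<^sup>+x. (\<integral>\<^sup>+z. f x * indicator (ball x s) z \<partial>lebesgue) \<partial>lebesgue)"
    using nn_integral_lebesgue_commute[OF m] by simp
  also have "\<dots> = (\<integral>\<^sup>+x. emeasure lebesgue (ball (0::'a) s) * f x \<partial>lebesgue)"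
  proof (intro nn_integral_cong)
    fix x
    have "(\<integral>\<^sup>+z. f x * indicator (ball x s) z \<partial>lebesgue) = f x * emeasure lebesgue (ball x s)"
      by (rule nn_integral_cmult_indicator) measurable
    also have "emeasure lebesgue (ball x s) = emeasure lebesgue (ball (0::'a) s)"
      using s by (simp add: emeasure_lebesgue_ball del: emeasure_completion)
    finally show "(\<integral>\<^sup>+z. f x * indicator (ball x s) z \<partial>lebesgue) = emeasure lebesgue (ball (0::'a) s) * f x"
      by (simp only: mult.commute)
  qed
  also have "\<dots> = emeasure lebesgue (ball (0::'a) s) * integral\<^sup>N lebesgue f"
    by (rule nn_integral_cmult) measurable
  finally show ?thesis .
qed

text \<open>
  The localised inequality is averaged over all centres \<open>z\<close>, which replaces a covering argument.
\<close>

lemma faber_krahn: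
  assumes P: "poincare_inequality \<mu> E \<alpha> C1" and C1: "0 \<le> C1"
    and v: "v \<in> H_space \<mu>" and supp: "\<And>x. v x \<noteq> 0 \<Longrightarrow> x \<in> ball x0 \<sigma>"
    and s: "0 < s" and E: "ball x0 (\<sigma> + 2 * s) \<subseteq> E"
    and small: "2 * emeasure lebesgue {x. v x \<noteq> 0} \<le> emeasure lebesgue (ball (0::'a) s)"
  shows "(\<integral>\<^sup>+x. ennreal ((v x)\<^sup>2) \<partial>lebesgue) \<le> ennreal (6 * C1 * s powr \<alpha>) * energy_sq \<mu> UNIV v"
proof -
  have [measurable]: "v \<in> borel_measurable lebesgue"
    using v by (auto simp: H_space_def L2_on_def lebesgue_on_UNIV_eq)
  have ball_eq: "emeasure lebesgue (ball z s) = emeasure lebesgue (ball (0::'a) s)" for z :: 'a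
    using s by (simp add: emeasure_lebesgue_ball del: emeasure_completion)
  have loc: "(\<integral>\<^sup>+x\<in>ball z s. ennreal ((v x)\<^sup>2) \<partial>lebesgue) \<le> ennreal (6 * C1 * s powr \<alpha>) * energy_sq \<mu> (ball z s) v" for z
  proof (cases "ball z s \<inter> ball x0 \<sigma> = {}")
    \<comment> \<open>Such a ball may leave \<open>E\<close>, where no Poincare inequality is
      available, but \<open>v\<close> vanishes on it.\<close>
    case True
    then have "(\<integral>\<^sup>+x\<in>ball z s. ennreal ((v x)\<^sup>2) \<partial>lebesgue) = (\<integral>\<^sup>+x. 0 \<partial>(lebesgue :: 'a measure))"
      using supp by (intro nn_integral_cong) (auto simp: indicator_def)
    then show ?thesis by simp
  next
    case False
    then obtain y where y: "dist z y < s" "dist x0 y < \<sigma>" by auto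
    \<comment> \<open>A ball meeting the support sticks out by at most its diameter, hence the
      margin 2 * s.\<close>
    have "ball z s \<subseteq> ball x0 (\<sigma> + 2 * s)"
    proof
      fix x assume "x \<in> ball z s"
      then show "x \<in> ball x0 (\<sigma> + 2 * s)"
        using y dist_triangle[of x0 x y] dist_triangle[of y x z] by (auto simp: dist_commute)
    qed
    with E have "ball z s \<subseteq> E" by blast
    then have "(\<integral>\<^sup>+x\<in>ball z s. ennreal ((v x - average (ball z s) v)\<^sup>2) \<partial>lebesgue)
        \<le> ennreal (C1 * s powr \<alpha>) * energy_sq \<mu> (ball z s) v"
      using P s H_space_subset_H_loc[OF v] unfolding poincare_inequality_def by blast
    then have "6 * (\<integral>\<^sup>+x\<in>ball z s. ennreal ((v x - average (ball z s) v)\<^sup>2) \<partial>lebesgue)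
        \<le> 6 * (ennreal (C1 * s powr \<alpha>) * energy_sq \<mu> (ball z s) v)"
      by (rule mult_left_mono) simp
    also have "\<dots> = ennreal (6 * C1 * s powr \<alpha>) * energy_sq \<mu> (ball z s) v"
      using C1 by (simp add: ennreal_mult mult.assoc)
    finally show ?thesis
      using nn_integral_square_le_deviation[of v s z "average (ball z s) v"] s small
      by (metis (no_types, lifting) \<open>v \<in> borel_measurable lebesgue\<close> ball_eq order_trans)
  qed
  let ?T = "emeasure lebesgue (ball (0::'a) s)"
  have T: "?T \<noteq> 0" "?T \<noteq> \<infinity>"
    using s unit_ball_vol_pos[of "real DIM('a)"] by (simp_all add: emeasure_lebesgue_ball del: emeasure_completion unit_ball_vol_pos)
  have "?T * (\<integral>\<^sup>+x. ennreal ((v x)\<^sup>2) \<partial>lebesgue) = (\<integral>\<^sup>+z. (\<integral>\<^sup>+x\<in>ball z s. ennreal ((v x)\<^sup>2) \<partial>lebesgue) \<partial>lebesgue)"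
    using s by (intro nn_integral_ball_average[symmetric]) measurable
  also have "\<dots> \<le> (\<integral>\<^sup>+z. ennreal (6 * C1 * s powr \<alpha>) * energy_sq \<mu> (ball z s) v \<partial>lebesgue)"
    by (intro nn_integral_mono loc)
  also have "\<dots> \<le> ennreal (6 * C1 * s powr \<alpha>) * (?T * energy_sq \<mu> UNIV v)"
    using s by (intro energy_sq_ball_nn_integral_le) measurable
  finally have "?T * (\<integral>\<^sup>+x. ennreal ((v x)\<^sup>2) \<partial>lebesgue) \<le> ?T * (ennreal (6 * C1 * s powr \<alpha>) * energy_sq \<mu> UNIV v)"
    by (simp add: mult.left_commute del: emeasure_completion)
  then show ?thesis
    using T by (simp add: ennreal_mult_le_mult_iff del: emeasure_completion)
qed

text \<open>UJS on the ball of radius d = |x - y| / 2 about \<open>x\<close> compares K(x,y) with an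
  average of K(.,y). That ball avoids the ball of radius d about \<open>y\<close>, so by symmetry
  the average is at most C2 * d^(-\<alpha>) over the ball's volume. Rewriting d in terms of |x - y|
  produces 2^(N+\<alpha>).\<close>

lemma kernel_upper_bound:
  assumes U: "UJS K c" and c: "0 \<le> c" and "x \<noteq> y"
  shows "K x y \<le> c * C2 * 2 powr (real DIM('a) + \<alpha>) / unit_ball_vol (real DIM('a))
    * norm (x - y) powr - (real DIM('a) + \<alpha>)"
proof -
  define d where "d = norm (x - y) / 2"
  define \<omega> where "\<omega> = unit_ball_vol (real DIM('a))"
  have d: "0 < d" "norm (x - y) = 2 * d" using \<open>x \<noteq> y\<close> by (auto simp: d_def)
  have \<omega>: "0 < \<omega>" by (simp add: \<omega>_def)
  have "(\<integral>\<^sup>+z\<in>ball x d. ennreal (K z y) \<partial>lebesgue) \<le> (\<integral>\<^sup>+z. indicator (- ball y d) z * ennreal (K y z) \<partial>lebesgue)"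
  proof (intro nn_integral_mono)
    fix z
    have "z \<notin> ball y d" if "z \<in> ball x d"
      using that d dist_triangle[of x y z] by (auto simp: dist_norm norm_minus_commute)
    then show "ennreal (K z y) * indicator (ball x d) z \<le> indicator (- ball y d) z * ennreal (K y z)"
      by (auto simp: indicator_def kernel_sym)
  qed
  also have "\<dots> = emeasure (\<mu> y) (- ball y d)"
    by (rule emeasure_kernel[symmetric]) measurable
  also have "\<dots> \<le> ennreal (C2 * d powr - \<alpha>)"
    using decay d by (auto simp: decay_estimate_def)
  finally have *: "(\<integral>\<^sup>+z\<in>ball x d. ennreal (K z y) \<partial>lebesgue) \<le> ennreal (C2 * d powr - \<alpha>)" .
  have "ennreal (K x y) \<le> ennreal (c / measure lebesgue (ball x d)) * (\<integral>\<^sup>+z\<in>ball x d. ennreal (K z y) \<partial>lebesgue)"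
    by (rule U[unfolded UJS_def, rule_format]) (use d in auto)
  also have "\<dots> \<le> ennreal (c / measure lebesgue (ball x d)) * ennreal (C2 * d powr - \<alpha>)"
    by (rule mult_left_mono[OF *]) simp
  also have "\<dots> = ennreal (c / (\<omega> * d ^ DIM('a)) * (C2 * d powr - \<alpha>))"
    using c C2_nonneg d \<omega> by (subst ennreal_mult) (auto simp: content_ball \<omega>_def)
  finally have "K x y \<le> c / (\<omega> * d ^ DIM('a)) * (C2 * d powr - \<alpha>)"
    using c C2_nonneg d \<omega> by (subst (asm) ennreal_le_iff) auto
  also have "\<dots> = c * C2 * 2 powr (real DIM('a) + \<alpha>) / \<omega> * norm (x - y) powr - (real DIM('a) + \<alpha>)"
  proof -
    have "norm (x - y) powr - (real DIM('a) + \<alpha>) = inverse (2 powr (real DIM('a) + \<alpha>) * (d powr real DIM('a) * d powr \<alpha>))"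
      unfolding d(2) powr_minus using d(1) by (simp add: powr_mult flip: powr_add)
    moreover have "d powr real DIM('a) = d ^ DIM('a)" using d by (simp add: powr_realpow)
    ultimately show ?thesis
      using d(1) by (simp add: powr_minus divide_inverse)
  qed
  finally show ?thesis by (simp add: \<omega>_def)
qed

end

subsection \<open>The De Giorgi iteration\<close>

definition ramp :: "'a::real_normed_vector \<Rightarrow> real \<Rightarrow> real \<Rightarrow> 'a \<Rightarrow> real" where
  "ramp x0 L \<sigma> x = max 0 (min 1 (L * (\<sigma> - dist x0 x)))"

lemma ramp_bounds: "0 \<le> ramp x0 L \<sigma> x" "ramp x0 L \<sigma> x \<le> 1"
  by (auto simp: ramp_def)

lemma ramp_support:
  assumes "0 < L" "ramp x0 L \<sigma> x \<noteq> 0"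
  shows "x \<in> ball x0 \<sigma>"
proof (rule ccontr)
  assume "x \<notin> ball x0 \<sigma>"
  then have "L * (\<sigma> - dist x0 x) \<le> 0"
    using assms(1) by (intro mult_nonneg_nonpos) auto
  then show False using assms(2) by (simp add: ramp_def)
qed

lemma ramp_eq_1: "0 < L \<Longrightarrow> dist x0 x + 1 / L \<le> \<sigma> \<Longrightarrow> ramp x0 L \<sigma> x = 1"
  by (auto simp: ramp_def field_simps)

lemma ramp_lipschitz:
  assumes "0 < L"
  shows "\<bar>ramp x0 L \<sigma> x - ramp x0 L \<sigma> y\<bar> \<le> L * norm (x - y)"
proof -
  have "\<bar>ramp x0 L \<sigma> x - ramp x0 L \<sigma> y\<bar> \<le> \<bar>L * (\<sigma> - dist x0 x) - L * (\<sigma> - dist x0 y)\<bar>"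
    unfolding ramp_def by linarith
  also have "\<dots> = L * \<bar>dist x0 y - dist x0 x\<bar>"
    using assms by (simp add: abs_mult flip: right_diff_distrib)
  also have "\<dots> \<le> L * norm (x - y)"
    using assms dist_triangle[of x0 x y] dist_triangle[of x0 y x]
    by (intro mult_left_mono) (auto simp: dist_norm norm_minus_commute)
  finally show ?thesis .
qed

lemma ramp_measurable [measurable]: "ramp x0 L \<sigma> \<in> borel_measurable lebesgue"
  for x0 :: "'a::euclidean_space"
  unfolding ramp_def
  by (intro measurable_completion) (simp add: borel_measurable_continuous_onI continuous_intros)

text \<open>Chebyshev between consecutive levels: above the higher level \<open>m\<close>, the
  excess over \<open>l\<close> is at least both \<open>h\<close> and t - m. This trades first powers
  and measures of level sets for square integrals.\<close>

lemma excess_bounds: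
  fixes t l m h :: real
  assumes "0 < h" "l + h \<le> m"
  shows "(max (t - m) 0)\<^sup>2 \<le> (max (t - l) 0)\<^sup>2"
    and "max (t - m) 0 \<le> (max (t - l) 0)\<^sup>2 / h"
    and "max (t - m) 0 \<noteq> 0 \<Longrightarrow> 1 \<le> (max (t - l) 0)\<^sup>2 / h\<^sup>2"
proof -
  show "(max (t - m) 0)\<^sup>2 \<le> (max (t - l) 0)\<^sup>2"
    using assms by (intro power_mono) auto
  show "max (t - m) 0 \<le> (max (t - l) 0)\<^sup>2 / h"
  proof (cases "t \<le> m")
    case False
    then have "(t - m) * h \<le> (t - l) * (t - l)"
      using assms by (intro mult_mono) auto
    then show ?thesis using False assms by (simp add: field_simps power2_eq_square)
  qed (use assms in auto)
  assume "max (t - m) 0 \<noteq> 0"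
  then have "h\<^sup>2 \<le> (max (t - l) 0)\<^sup>2"
    using assms by (intro power_mono) (auto simp: max_def split: if_splits)
  then show "1 \<le> (max (t - l) 0)\<^sup>2 / h\<^sup>2"
    using assms by simp
qed

context subsolution_setup
begin

definition level :: "real \<Rightarrow> nat \<Rightarrow> real" where
  "level k j = k * (1 - (1/2) ^ j)"

text \<open>The radii fall from 3/4 * r to r/2. Starting below r leaves room for the Poincare balls
  and for the 7/8 restriction on supports.\<close>

definition radius :: "nat \<Rightarrow> real" where
  "radius j = r / 2 + (1/2) ^ j * r / 4"

definition excess :: "real \<Rightarrow> nat \<Rightarrow> ennreal" where
  "excess k j = (\<integral>\<^sup>+x\<in>ball x0 (radius j). ennreal ((max (u x - level k j) 0)\<^sup>2) \<partial>lebesgue)"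

context
  fixes p :: real
  assumes p: "\<alpha> \<le> p"
begin

text \<open>Recentres the kernel bound from \<open>x\<close> to \<open>x0\<close>, so that one tail
  integral serves all \<open>x\<close>: as |x - y| \<ge> g and r \<le> (c - 1) g, the triangle
  inequality gives |y - x0| \<le> c |x - y|. In the application \<open>p\<close> is N +
  \<alpha>.\<close>

lemma far_kernel_bound:
  assumes kb: "\<And>x y. x \<noteq> y \<Longrightarrow> K x y \<le> \<Lambda> * norm (x - y) powr - p" and \<Lambda>: "0 \<le> \<Lambda>"
    and g: "0 < g" and x: "dist x0 x < r" and y: "g \<le> norm (x - y)" and c: "r + g \<le> c * g" and xy: "y \<noteq> x0"
  shows "K x y \<le> \<Lambda> * c powr p * norm (y - x0) powr - p"
proof -
  have n: "0 < norm (x - y)" using g y by linarith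
  have c0: "0 < c" using c g r(1) by (smt (verit) zero_less_mult_pos2)
  have c1: "r \<le> (c - 1) * g" using c by (simp add: algebra_simps)
  also have "\<dots> \<le> (c - 1) * norm (x - y)"
    using y c1 r(1) g by (intro mult_left_mono) (auto simp: zero_less_mult_iff dest: less_le_trans)
  finally have "r \<le> (c - 1) * norm (x - y)" .
  moreover have "norm (y - x0) \<le> norm (x - y) + dist x0 x"
    by (metis dist_norm dist_commute dist_triangle add.commute)
  ultimately have le: "norm (y - x0) \<le> c * norm (x - y)"
    using x by (simp add: algebra_simps)
  have "norm (x - y) powr - p = c powr p * (c * norm (x - y)) powr - p"
    using c0 n by (simp add: powr_mult powr_minus)
  also have "\<dots> \<le> c powr p * norm (y - x0) powr - p"
    using le xy alpha p by (intro mult_left_mono powr_mono2') auto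
  finally have "\<Lambda> * norm (x - y) powr - p \<le> \<Lambda> * (c powr p * norm (y - x0) powr - p)"
    using \<Lambda> by (rule mult_left_mono)
  moreover have "x \<noteq> y" using n by auto
  ultimately show ?thesis using kb[of x y] by (simp add: mult.assoc)
qed

text \<open>The radius \<open>s\<close> is a free parameter: shrinking it improves the factor
  s^\<alpha>, and \<open>small\<close> records how far it may shrink before Faber--Krahn fails for
  the set above the next level.\<close>

lemma de_giorgi_step:
  fixes \<Lambda> T \<delta> k s C1 :: real and j :: nat
  assumes P: "poincare_inequality \<mu> E \<alpha> C1" and C1: "0 \<le> C1"
    and kb: "\<And>x y. x \<noteq> y \<Longrightarrow> K x y \<le> \<Lambda> * norm (x - y) powr - p" and \<Lambda>: "0 \<le> \<Lambda>"
    and T: "0 \<le> T" "(\<integral>\<^sup>+x\<in>- ball x0 (r / 2). ennreal (max (u x) 0 / norm (x - x0) powr p) \<partial>lebesgue) \<le> ennreal T"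
    and \<delta>: "0 < \<delta>" "\<delta> \<le> 1" and k: "0 < k" "\<delta> * r powr \<alpha> * T \<le> k"
    and s: "0 < s" "s \<le> r / 8"
    and small: "ennreal (8 * 4 ^ j / k\<^sup>2) * excess k j \<le> emeasure lebesgue (ball (0::'a) s)"
  shows "excess k (Suc j)
    \<le> ennreal (6 * C1 * s powr \<alpha> * ((C3 * 16 powr \<alpha> + 4 * \<Lambda> * 17 powr p) * (2 powr (p + 1)) ^ j / (\<delta> * r powr \<alpha>))) * excess k j"
proof -
  define m where "m = level k (Suc j)"
  define h where "h = k / 2 ^ Suc j"
  \<comment> \<open>Consecutive radii differ by 2^(-j) * r/8; \<sigma> is their midpoint and 1/L
    half the gap. So the cutoff is 1 on the next ball, and its support keeps distance 1/L from the
    complement of the current one.\<close>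
  define L where "L = 16 * 2 ^ j / r"
  define \<sigma> where "\<sigma> = r / 2 + (1/2) ^ j * (3 / 16 * r)"
  define w where "w x = max (u x - m) 0" for x
  define v where "v x = ramp x0 L \<sigma> x * w x" for x
  let ?B = "ball x0 (radius j)"
  let ?e = "\<lambda>x. ennreal ((max (u x - level k j) 0)\<^sup>2)"
  have pow: "0 < (1/2::real) ^ j" "(1/2::real) ^ j \<le> 1"
    by (auto simp: power_le_one)
  have h: "0 < h" "level k j + h \<le> m"
    using k by (auto simp: h_def m_def level_def field_simps power_one_over)
  have m: "0 \<le> m"
    using k pow unfolding m_def level_def by (intro mult_nonneg_nonneg) auto
  have L: "0 < L" using r by (simp add: L_def)
  have gap: "1 / L = (1/2) ^ j * (r / 16)"
    using r by (simp add: L_def field_simps power_one_over)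
  have gap_le: "1 / L \<le> r / 16"
    unfolding gap using pow r mult_right_mono[of "(1/2::real) ^ j" 1 "r / 16"] by simp
  have \<sigma>: "0 < \<sigma>" "\<sigma> \<le> 11 / 16 * r"
    using r pow mult_right_mono[of "(1/2::real) ^ j" 1 "3 / 16 * r"] by (auto simp: \<sigma>_def intro!: add_pos_nonneg)
  have \<sigma>_radius: "\<sigma> + 1 / L = radius j" "radius (Suc j) + 1 / L = \<sigma>"
    by (simp_all add: gap \<sigma>_def radius_def algebra_simps)
  have radius_le: "\<sigma> \<le> radius j" using \<sigma>_radius(1) L by (smt (verit) divide_pos_pos)
  have half: "r / 2 \<le> radius j" using r pow by (simp add: radius_def)
  have [measurable]: "w \<in> borel_measurable lebesgue" "v \<in> borel_measurable lebesgue"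
    unfolding w_def v_def by measurable
  have vH: "v \<in> H_space \<mu>"
    unfolding v_def w_def
    by (rule cutoff_mult_in_H_space[of m L \<sigma>]) (use m L \<sigma> r ramp_bounds ramp_support ramp_lipschitz in auto)
  have vsupp: "x \<in> ball x0 \<sigma>" if "v x \<noteq> 0" for x
    using that ramp_support[OF L] by (auto simp: v_def)
  have e: "excess k j = (\<integral>\<^sup>+x. ?e x * indicator ?B x \<partial>lebesgue)"
    by (simp add: excess_def)
  define M where "M = ennreal (\<Lambda> * (17 * 2 ^ j) powr p * T)"
  have tail: "(\<integral>\<^sup>+y. ennreal (w y) * indicator (- ?B) y * ennreal (K x y) \<partial>lebesgue) \<le> M" if x: "x \<in> ball x0 \<sigma>" for x
  proof -
    have "(\<integral>\<^sup>+y. ennreal (w y) * indicator (- ?B) y * ennreal (K x y) \<partial>lebesgue)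
      \<le> (\<integral>\<^sup>+y. ennreal (\<Lambda> * (17 * 2 ^ j) powr p) *
          (ennreal (max (u y) 0 / norm (y - x0) powr p) * indicator (- ball x0 (r / 2)) y) \<partial>lebesgue)"
    proof (intro nn_integral_mono)
      fix y
      show "ennreal (w y) * indicator (- ?B) y * ennreal (K x y)
        \<le> ennreal (\<Lambda> * (17 * 2 ^ j) powr p) *
          (ennreal (max (u y) 0 / norm (y - x0) powr p) * indicator (- ball x0 (r / 2)) y)"
      proof (cases "y \<in> ?B")
        case False
        then have "radius j \<le> dist x0 y" by auto
        moreover have "dist x0 y \<le> dist x0 x + norm (x - y)"
          by (metis dist_norm dist_triangle)
        ultimately have g: "1 / L \<le> norm (x - y)"
          using x \<sigma>_radius by auto
        have "K x y \<le> \<Lambda> * (17 * 2 ^ j) powr p * norm (y - x0) powr - p"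
        proof (rule far_kernel_bound[OF kb \<Lambda> _ _ g])
          show "0 < 1 / L" using L by simp
          show "dist x0 x < r" using x \<sigma> r by auto
          show "y \<noteq> x0" using False half r by auto
          \<comment> \<open>Origin of 17: 2^j / L is r/16, and one further sixteenth of r absorbs
            1/L.\<close>
          have "17 * 2 ^ j * (1 / L) = r + r / 16"
            using r by (simp add: L_def field_simps)
          with gap_le show "r + 1 / L \<le> 17 * 2 ^ j * (1 / L)" by linarith
        qed
        then have "w y * K x y \<le> max (u y) 0 * (\<Lambda> * (17 * 2 ^ j) powr p * norm (y - x0) powr - p)"
          using m kernel_nonneg by (intro mult_mono) (auto simp: w_def)
        also have "\<dots> = \<Lambda> * (17 * 2 ^ j) powr p * (max (u y) 0 / norm (y - x0) powr p)"
          by (simp add: powr_minus divide_inverse)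
        finally have "ennreal (w y * K x y) \<le> ennreal (\<Lambda> * (17 * 2 ^ j) powr p * (max (u y) 0 / norm (y - x0) powr p))"
          by (rule ennreal_leI)
        moreover have "ennreal (w y * K x y) = ennreal (w y) * ennreal (K x y)"
          by (rule ennreal_mult) (auto simp: w_def kernel_nonneg)
        moreover have "ennreal (\<Lambda> * (17 * 2 ^ j) powr p * (max (u y) 0 / norm (y - x0) powr p))
            = ennreal (\<Lambda> * (17 * 2 ^ j) powr p) * ennreal (max (u y) 0 / norm (y - x0) powr p)"
          using \<Lambda> by (intro ennreal_mult) auto
        moreover have "y \<notin> ball x0 (r / 2)" using False half by auto
        ultimately show ?thesis using False by (simp add: indicator_def)
      qed simp
    qed
    also have "\<dots> = ennreal (\<Lambda> * (17 * 2 ^ j) powr p) *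
        (\<integral>\<^sup>+y\<in>- ball x0 (r / 2). ennreal (max (u y) 0 / norm (y - x0) powr p) \<partial>lebesgue)"
      by (rule nn_integral_cmult) (simp add: norm_minus_commute[of _ x0])
    also have "\<dots> \<le> ennreal (\<Lambda> * (17 * 2 ^ j) powr p) * ennreal T"
      by (intro mult_left_mono T) simp
    also have "\<dots> = M"
      using \<Lambda> T unfolding M_def by (intro ennreal_mult[symmetric]) auto
    finally show ?thesis .
  qed
  have "energy_sq \<mu> UNIV v
    \<le> ennreal (C3 * L powr \<alpha>) * (\<integral>\<^sup>+x. ennreal ((w x)\<^sup>2) * indicator ?B x \<partial>lebesgue)
      + 2 * M * (\<integral>\<^sup>+x. ennreal (w x) * indicator ?B x \<partial>lebesgue)"
    unfolding v_def w_def
    by (rule energy_truncation_le[of m L \<sigma>])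
      (use m L \<sigma> r ramp_bounds ramp_support ramp_lipschitz radius_le tail[unfolded w_def] in auto)
  also have "\<dots> \<le> ennreal (C3 * L powr \<alpha>) * excess k j + 2 * M * (ennreal (1 / h) * excess k j)"
  proof (intro add_mono mult_left_mono)
    show "(\<integral>\<^sup>+x. ennreal ((w x)\<^sup>2) * indicator ?B x \<partial>lebesgue) \<le> excess k j"
      unfolding e w_def using excess_bounds(1)[OF h] by (intro nn_integral_mono mult_right_mono ennreal_leI) auto
    have "(\<integral>\<^sup>+x. ennreal (w x) * indicator ?B x \<partial>lebesgue) \<le> (\<integral>\<^sup>+x. ennreal (1 / h) * (?e x * indicator ?B x) \<partial>lebesgue)"
    proof (intro nn_integral_mono)
      fix x
      have "ennreal (w x) \<le> ennreal (1 / h * (max (u x - level k j) 0)\<^sup>2)"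
        unfolding w_def using excess_bounds(2)[OF h, of "u x"] by (intro ennreal_leI) simp
      also have "\<dots> = ennreal (1 / h) * ?e x"
        using h by (intro ennreal_mult) auto
      finally show "ennreal (w x) * indicator ?B x \<le> ennreal (1 / h) * (?e x * indicator ?B x)"
        by (simp add: indicator_def)
    qed
    also have "\<dots> = ennreal (1 / h) * excess k j"
      unfolding e by (rule nn_integral_cmult) measurable
    finally show "(\<integral>\<^sup>+x. ennreal (w x) * indicator ?B x \<partial>lebesgue) \<le> ennreal (1 / h) * excess k j" .
  qed auto
  also have "\<dots> = ennreal (C3 * L powr \<alpha> + 2 * (\<Lambda> * (17 * 2 ^ j) powr p * T) * (1 / h)) * excess k j"
  proof -
    have nn: "0 \<le> \<Lambda> * (17 * 2 ^ j) powr p * T" using \<Lambda> T by simp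
    have "2 * M * (ennreal (1 / h) * excess k j) = ennreal (2 * (\<Lambda> * (17 * 2 ^ j) powr p * T) * (1 / h)) * excess k j"
      unfolding M_def using nn h by (subst ennreal_mult, simp, simp, subst ennreal_mult, simp, simp) (simp add: mult.assoc)
    then show ?thesis
      using nn h C3_nonneg by (subst ennreal_plus) (auto simp: distrib_right)
  qed
  also have "\<dots> \<le> ennreal ((C3 * 16 powr \<alpha> + 4 * \<Lambda> * 17 powr p) * (2 powr (p + 1)) ^ j / (\<delta> * r powr \<alpha>)) * excess k j"
  proof (intro mult_right_mono ennreal_leI)
    have R: "0 < r powr \<alpha>" using r by simp
    define Z where "Z = (2 powr (p + 1)) ^ j / (\<delta> * r powr \<alpha>)"
    have b: "(2 powr (p + 1)) ^ j = (2 ^ j) powr p * 2 ^ j"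
    proof -
      have "(2 powr (p + 1)) ^ j = 2 powr ((p + 1) * j)"
        by (simp add: powr_powr flip: powr_realpow)
      also have "\<dots> = 2 powr (j * p) * 2 powr j"
        by (simp add: algebra_simps flip: powr_add)
      finally show ?thesis by (simp add: powr_realpow flip: powr_powr)
    qed
    have "L powr \<alpha> = 16 powr \<alpha> * (2 ^ j) powr \<alpha> / r powr \<alpha>"
      using r by (simp add: L_def powr_divide powr_mult)
    \<comment> \<open>The local term carries no \<delta>; \<delta> \<le> 1 and \<alpha> \<le> p
      weaken it to the shape of the tail term.\<close>
    also have "\<dots> \<le> 16 powr \<alpha> * ((2 ^ j) powr p * 2 ^ j) / (\<delta> * r powr \<alpha>)"
    proof (intro frac_le mult_left_mono)
      have "(2 ^ j) powr \<alpha> * 1 \<le> (2 ^ j) powr p * (2 ^ j :: real)"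
        using p by (intro mult_mono powr_mono) auto
      then show "(2 ^ j) powr \<alpha> \<le> (2 ^ j) powr p * (2 ^ j :: real)" by simp
      show "\<delta> * r powr \<alpha> \<le> r powr \<alpha>" using \<delta> R by (simp add: mult_left_le_one_le)
    qed (use \<delta> R in auto)
    finally have 1: "C3 * L powr \<alpha> \<le> C3 * (16 powr \<alpha> * Z)"
      using C3_nonneg unfolding Z_def b by (intro mult_left_mono) auto
    \<comment> \<open>The lower bound on \<open>k\<close> eliminates the tail here. The base 2^(p+1)
      collects 2^p per step from the recentred kernel and 2 from the level gap 1/h.\<close>
    have "T / k \<le> 1 / (\<delta> * r powr \<alpha>)"
      using k \<delta> R by (simp add: field_simps)
    then have "(2 * \<Lambda> * (17 * 2 ^ j) powr p * 2 ^ Suc j) * (T / k) \<le> (2 * \<Lambda> * (17 * 2 ^ j) powr p * 2 ^ Suc j) * (1 / (\<delta> * r powr \<alpha>))"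
      using \<Lambda> by (intro mult_left_mono) auto
    then have "2 * (\<Lambda> * (17 * 2 ^ j) powr p * T) * (1 / h) \<le> 4 * \<Lambda> * 17 powr p * Z"
      unfolding Z_def b h_def by (simp add: powr_mult mult_ac)
    with 1 have "C3 * L powr \<alpha> + 2 * (\<Lambda> * (17 * 2 ^ j) powr p * T) * (1 / h)
        \<le> (C3 * 16 powr \<alpha> + 4 * \<Lambda> * 17 powr p) * Z"
      by (simp add: algebra_simps)
    then show "C3 * L powr \<alpha> + 2 * (\<Lambda> * (17 * 2 ^ j) powr p * T) * (1 / h)
        \<le> (C3 * 16 powr \<alpha> + 4 * \<Lambda> * 17 powr p) * (2 powr (p + 1)) ^ j / (\<delta> * r powr \<alpha>)"
      by (simp add: Z_def)
  qed simp
  finally have energy: "energy_sq \<mu> UNIV v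
    \<le> ennreal ((C3 * 16 powr \<alpha> + 4 * \<Lambda> * 17 powr p) * (2 powr (p + 1)) ^ j / (\<delta> * r powr \<alpha>)) * excess k j" .
  have "excess k (Suc j) \<le> (\<integral>\<^sup>+x. ennreal ((v x)\<^sup>2) \<partial>lebesgue)"
    unfolding excess_def
  proof (intro nn_integral_mono)
    fix x
    show "ennreal ((max (u x - level k (Suc j)) 0)\<^sup>2) * indicator (ball x0 (radius (Suc j))) x \<le> ennreal ((v x)\<^sup>2)"
    proof (cases "x \<in> ball x0 (radius (Suc j))")
      case True
      then have "ramp x0 L \<sigma> x = 1"
        using \<sigma>_radius(2) by (intro ramp_eq_1[OF L]) auto
      then show ?thesis using True by (simp add: v_def w_def m_def)
    qed simp
  qed
  also have "\<dots> \<le> ennreal (6 * C1 * s powr \<alpha>) * energy_sq \<mu> UNIV v"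
  proof (rule faber_krahn[OF P C1 vH vsupp s(1)])
    \<comment> \<open>11/16 * r + 2 * r/8 = 15/16 * r, which is below R.\<close>
    have "ball x0 (\<sigma> + 2 * s) \<subseteq> ball x0 R"
      using \<sigma> s r by auto
    then show "ball x0 (\<sigma> + 2 * s) \<subseteq> E" using ball_E by blast
    have "{x \<in> space lebesgue. v x \<noteq> 0} \<in> sets lebesgue" by measurable
    then have [measurable]: "{x. v x \<noteq> 0} \<in> sets lebesgue" by simp
    have "emeasure lebesgue {x. v x \<noteq> 0} = (\<integral>\<^sup>+x. indicator {x. v x \<noteq> 0} x \<partial>lebesgue)"
      by (rule nn_integral_indicator[symmetric]) measurable
    \<comment> \<open>Where \<open>v\<close> is non-zero, \<open>u\<close> exceeds the current level
      by at least \<open>h\<close>.\<close>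
    also have "\<dots> \<le> (\<integral>\<^sup>+x. ennreal (1 / h\<^sup>2) * (?e x * indicator ?B x) \<partial>lebesgue)"
    proof (intro nn_integral_mono)
      fix x
      show "indicator {x. v x \<noteq> 0} x \<le> ennreal (1 / h\<^sup>2) * (?e x * indicator ?B x)"
      proof (cases "v x = 0")
        case False
        then have "max (u x - m) 0 \<noteq> 0" by (auto simp: v_def w_def)
        then have "ennreal 1 \<le> ennreal (1 / h\<^sup>2 * (max (u x - level k j) 0)\<^sup>2)"
          using excess_bounds(3)[OF h, of "u x"] by (intro ennreal_leI) simp
        also have "\<dots> = ennreal (1 / h\<^sup>2) * ?e x"
          using h by (intro ennreal_mult) auto
        finally show ?thesis
          using vsupp[OF False] radius_le by (simp add: indicator_def)
      qed simp
    qed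
    also have "\<dots> = ennreal (1 / h\<^sup>2) * excess k j"
      unfolding e by (rule nn_integral_cmult) measurable
    finally have "2 * emeasure lebesgue {x. v x \<noteq> 0} \<le> 2 * (ennreal (1 / h\<^sup>2) * excess k j)"
      by (rule mult_left_mono) simp
    also have "\<dots> = ennreal (8 * 4 ^ j / k\<^sup>2) * excess k j"
    proof -
      have "(2 ^ Suc j :: real)\<^sup>2 = 4 * 4 ^ j"
        by (simp add: power2_eq_square flip: power_mult_distrib)
      then have "2 * (1 / h\<^sup>2) = 8 * 4 ^ j / k\<^sup>2"
        unfolding h_def power_divide by simp
      moreover have "2 * ennreal (1 / h\<^sup>2) = ennreal (2 * (1 / h\<^sup>2))"
        by (subst ennreal_mult) auto
      ultimately show ?thesis by (simp add: mult.assoc[symmetric])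
    qed
    also note small
    finally show "2 * emeasure lebesgue {x. v x \<noteq> 0} \<le> emeasure lebesgue (ball (0::'a) s)" .
  qed
  also have "\<dots> \<le> ennreal (6 * C1 * s powr \<alpha>) *
      (ennreal ((C3 * 16 powr \<alpha> + 4 * \<Lambda> * 17 powr p) * (2 powr (p + 1)) ^ j / (\<delta> * r powr \<alpha>)) * excess k j)"
    by (rule mult_left_mono[OF energy]) simp
  also have "\<dots> = ennreal (6 * C1 * s powr \<alpha> * ((C3 * 16 powr \<alpha> + 4 * \<Lambda> * 17 powr p) * (2 powr (p + 1)) ^ j / (\<delta> * r powr \<alpha>))) * excess k j"
    using C1 C3_nonneg \<Lambda> \<delta> by (subst ennreal_mult[of "6 * C1 * s powr \<alpha>"]) (auto simp: mult.assoc)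
  finally show ?thesis .
qed

end

section \<open>Geometric decay of the excess and the resulting bound\<close>

context
  fixes p \<Lambda> T \<delta> k C1 Q A :: real
  assumes p: "\<alpha> \<le> p"
    and P: "poincare_inequality \<mu> E \<alpha> C1" and C1: "0 \<le> C1"
    and kb: "\<And>x y. x \<noteq> y \<Longrightarrow> K x y \<le> \<Lambda> * norm (x - y) powr - p" and \<Lambda>: "0 \<le> \<Lambda>"
    and T: "0 \<le> T" "(\<integral>\<^sup>+x\<in>- ball x0 (r / 2). ennreal (max (u x) 0 / norm (x - x0) powr p) \<partial>lebesgue) \<le> ennreal T"
    and \<delta>: "0 < \<delta>" "\<delta> \<le> 1" and k: "0 < k" "\<delta> * r powr \<alpha> * T \<le> k"
    and A: "8 powr \<alpha> \<le> A" "6 * C1 * (C3 * 16 powr \<alpha> + 4 * \<Lambda> * 17 powr p) \<le> A"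
    and Q: "0 \<le> Q" "(\<integral>\<^sup>+x\<in>B. ennreal ((max (u x) 0)\<^sup>2) \<partial>lebesgue) \<le> ennreal Q"
begin

text \<open>The radius at step j is s0 * q^j. The ratio \<open>q\<close> solves q^\<alpha> * 2^(p+1)
  = 1, which cancels the growth of the energy factor. The value of \<eta> makes 4 * \<eta> = q^N, so
  the Chebyshev bound shrinks exactly like the volume of the balls, and \<open>start\<close>, the
  smallness condition at j = 0, propagates.\<close>

lemma de_giorgi_iteration:
  defines "q \<equiv> (2 powr (p + 1)) powr (- (1 / \<alpha>))"
  defines "\<eta> \<equiv> q ^ DIM('a) / 4"
  defines "s0 \<equiv> r * (\<eta> * \<delta> / A) powr (1 / \<alpha>)"
  assumes start: "8 * Q \<le> k\<^sup>2 * (unit_ball_vol (real DIM('a)) * s0 ^ DIM('a))"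
  shows "0 < \<eta> \<and> \<eta> < 1 \<and> excess k j \<le> ennreal (Q * \<eta> ^ j)"
proof -
  define b where "b = (2::real) powr (p + 1)"
  define D where "D = 6 * C1 * (C3 * 16 powr \<alpha> + 4 * \<Lambda> * 17 powr p)"
  have D: "0 \<le> D" "D \<le> A"
    using A(2) C1 C3_nonneg \<Lambda> by (auto simp: D_def)
  have b: "1 \<le> b"
    using p alpha by (auto simp: b_def intro!: ge_one_powr_ge_zero)
  have q: "0 < q" "q \<le> 1"
  proof -
    show "0 < q" by (simp add: q_def)
    have "b powr (- (1 / \<alpha>)) \<le> b powr 0"
      using b alpha by (intro powr_mono) auto
    then show "q \<le> 1" using b by (simp add: q_def b_def)
  qed
  have qb: "q powr \<alpha> * b = 1"
    unfolding q_def b_def[symmetric] powr_powr using b alpha by (simp add: powr_minus)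
  have \<eta>: "0 < \<eta>" "\<eta> < 1"
    using q power_le_one[of q "DIM('a)"] by (auto simp: \<eta>_def)
  have A0: "0 < A"
    using A(1) by (rule less_le_trans[rotated]) simp
  \<comment> \<open>The bound \<open>8 powr \<alpha> \<le> A\<close> secures s0 \<le> r/8, which
    keeps the Poincare balls inside \<open>E\<close>.\<close>
  have base: "0 < \<eta> * \<delta> / A" "\<eta> * \<delta> / A \<le> 8 powr - \<alpha>"
  proof -
    show "0 < \<eta> * \<delta> / A" using \<eta> \<delta> A0 by simp
    have "\<eta> * \<delta> / A \<le> 1 * 1 / 8 powr \<alpha>"
      using \<eta> \<delta> A(1) by (intro frac_le mult_mono) auto
    then show "\<eta> * \<delta> / A \<le> 8 powr - \<alpha>" by (simp add: powr_minus divide_inverse)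
  qed
  have s0: "0 < s0" "s0 \<le> r / 8"
  proof -
    show "0 < s0" unfolding s0_def using base(1) r(1) by (intro mult_pos_pos) auto
    have "(\<eta> * \<delta> / A) powr (1 / \<alpha>) \<le> (8 powr - \<alpha>) powr (1 / \<alpha>)"
      using base alpha by (intro powr_mono2) auto
    also have "\<dots> = 1 / 8"
      unfolding powr_powr using alpha by (simp add: powr_minus)
    finally have "r * (\<eta> * \<delta> / A) powr (1 / \<alpha>) \<le> r * (1 / 8)"
      using r by (intro mult_left_mono) auto
    then show "s0 \<le> r / 8" by (simp add: s0_def)
  qed
  have s0\<alpha>: "s0 powr \<alpha> = r powr \<alpha> * (\<eta> * \<delta> / A)"
  proof -
    have one: "1 / \<alpha> * \<alpha> = 1" using alpha by simp
    have "((\<eta> * \<delta> / A) powr (1 / \<alpha>)) powr \<alpha> = \<eta> * \<delta> / A"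
      unfolding powr_powr one by (rule powr_one) (rule less_imp_le[OF base(1)])
    then show ?thesis
      using r unfolding s0_def by (subst powr_mult) auto
  qed
  have "excess k j \<le> ennreal (Q * \<eta> ^ j)"
  proof (induction j)
    case 0
    have "excess k 0 \<le> (\<integral>\<^sup>+x\<in>B. ennreal ((max (u x) 0)\<^sup>2) \<partial>lebesgue)"
      unfolding excess_def using r by (intro nn_integral_mono) (auto simp: radius_def level_def indicator_def)
    also note Q(2)
    finally show ?case by simp
  next
    case (Suc j)
    define s where "s = s0 * q ^ j"
    have qj: "0 < q ^ j" "q ^ j \<le> 1" using q by (auto simp: power_le_one)
    have s: "0 < s" "s \<le> r / 8"
    proof -
      show "0 < s" using s0 qj by (simp add: s_def)
      have "s0 * q ^ j \<le> s0 * 1" using s0 qj by (intro mult_left_mono) auto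
      then show "s \<le> r / 8" unfolding s_def using s0(2) by linarith
    qed
    have "ennreal (8 * 4 ^ j / k\<^sup>2) * excess k j \<le> ennreal (8 * 4 ^ j / k\<^sup>2) * ennreal (Q * \<eta> ^ j)"
      by (rule mult_left_mono[OF Suc]) simp
    also have "\<dots> = ennreal (8 * 4 ^ j / k\<^sup>2 * (Q * \<eta> ^ j))"
      using Q \<eta> by (intro ennreal_mult[symmetric]) auto
    also have "8 * 4 ^ j / k\<^sup>2 * (Q * \<eta> ^ j) = (8 * Q / k\<^sup>2) * (4 * \<eta>) ^ j"
      by (simp add: power_mult_distrib)
    also have "(8 * Q / k\<^sup>2) * (4 * \<eta>) ^ j \<le> (unit_ball_vol (real DIM('a)) * s0 ^ DIM('a)) * (4 * \<eta>) ^ j"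
      using start k \<eta> by (intro mult_right_mono) (auto simp: field_simps)
    also have "\<dots> = unit_ball_vol (real DIM('a)) * s ^ DIM('a)"
      by (simp add: \<eta>_def s_def power_mult_distrib power_mult[symmetric] mult.commute)
    also have "ennreal (unit_ball_vol (real DIM('a)) * s ^ DIM('a)) = emeasure lebesgue (ball (0::'a) s)"
      using s by (simp add: emeasure_lebesgue_ball del: emeasure_completion)
    finally have small: "ennreal (8 * 4 ^ j / k\<^sup>2) * excess k j \<le> emeasure lebesgue (ball (0::'a) s)"
      by (auto simp: ennreal_leI)
    have "excess k (Suc j) \<le> ennreal (6 * C1 * s powr \<alpha> * ((C3 * 16 powr \<alpha> + 4 * \<Lambda> * 17 powr p) * b ^ j / (\<delta> * r powr \<alpha>))) * excess k j"
      unfolding b_def by (rule de_giorgi_step[OF p P C1 kb \<Lambda> T \<delta> k s small])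
    also have "6 * C1 * s powr \<alpha> * ((C3 * 16 powr \<alpha> + 4 * \<Lambda> * 17 powr p) * b ^ j / (\<delta> * r powr \<alpha>))
        = D * (s powr \<alpha> * b ^ j) / (\<delta> * r powr \<alpha>)"
      by (simp add: D_def)
    also have "s powr \<alpha> * b ^ j = s0 powr \<alpha> * (q powr \<alpha> * b) ^ j"
    proof -
      have "(q ^ j) powr \<alpha> = (q powr \<alpha>) ^ j"
        using q by (simp add: powr_powr mult.commute flip: powr_realpow)
      then show ?thesis
        using s0 q by (simp add: s_def powr_mult power_mult_distrib)
    qed
    \<comment> \<open>\<open>s0\<close> was chosen so that \<delta> and r^\<alpha> cancel; as
      \<open>A\<close> dominates \<open>D\<close>, the factor left is at most \<eta>.\<close>
    also have "D * (s0 powr \<alpha> * (q powr \<alpha> * b) ^ j) / (\<delta> * r powr \<alpha>) = (D / A) * \<eta>"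
      using r \<delta> A0 unfolding qb s0\<alpha> by (simp add: field_simps)
    also have "ennreal ((D / A) * \<eta>) * excess k j \<le> ennreal \<eta> * ennreal (Q * \<eta> ^ j)"
      using D A0 \<eta> by (intro mult_mono ennreal_leI Suc mult_left_le_one_le) auto
    also have "\<dots> = ennreal (\<eta> * (Q * \<eta> ^ j))"
      using Q \<eta> by (intro ennreal_mult[symmetric]) auto
    finally show ?case by (simp add: mult_ac)
  qed
  with \<eta> show ?thesis by simp
qed

text \<open>All levels stay below \<open>k\<close> and all radii above r/2, so each excess dominates
  the integral of the squared part of \<open>u\<close> above \<open>k\<close> over the half ball;
  the excesses tend to 0.\<close>

lemma AE_le_level:
  assumes "8 * Q \<le> k\<^sup>2 * (unit_ball_vol (real DIM('a)) *
    (r * (((2 powr (p + 1)) powr (- (1 / \<alpha>))) ^ DIM('a) / 4 * \<delta> / A) powr (1 / \<alpha>)) ^ DIM('a))"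
  shows "AE x in lebesgue_on (ball x0 (r / 2)). u x \<le> k"
proof -
  define \<eta> where "\<eta> = ((2 powr (p + 1)) powr (- (1 / \<alpha>))) ^ DIM('a) / 4"
  let ?I = "\<integral>\<^sup>+x\<in>ball x0 (r / 2). ennreal ((max (u x - k) 0)\<^sup>2) \<partial>lebesgue"
  note it = de_giorgi_iteration[OF assms, folded \<eta>_def]
  have \<eta>: "0 < \<eta>" "\<eta> < 1" using it by auto
  have le: "?I \<le> ennreal (Q * \<eta> ^ j)" for j
  proof -
    have "level k j \<le> k" "r / 2 \<le> radius j"
      using k r by (auto simp: level_def radius_def mult_le_cancel_left1)
    then have "?I \<le> excess k j"
      unfolding excess_def
      by (intro nn_integral_mono) (auto simp: indicator_def intro!: ennreal_leI power_mono)
    with it[of j] show ?thesis by (meson order_trans)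
  qed
  have "(\<lambda>j. ennreal (Q * \<eta> ^ j)) \<longlonglongrightarrow> ennreal (Q * 0)"
    using \<eta> by (intro tendsto_ennrealI tendsto_mult tendsto_const LIMSEQ_power_zero) auto
  then have "?I \<le> 0"
    using le by (intro LIMSEQ_le_const) auto
  then have "?I = 0" by simp
  then have "AE x in lebesgue. ennreal ((max (u x - k) 0)\<^sup>2) * indicator (ball x0 (r / 2)) x = 0"
    by (subst (asm) nn_integral_0_iff_AE) auto
  then have "AE x in lebesgue. x \<in> ball x0 (r / 2) \<longrightarrow> u x \<le> k"
    by eventually_elim (auto simp: indicator_def max_def split: if_splits)
  then show ?thesis
    by (subst AE_restrict_space_iff) auto
qed

end

text \<open>Since r < R, \<open>u\<close> is square integrable on \<open>B\<close>; hence the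
  Bochner integral in \<open>average\<close> is the true value and not the default 0.\<close>

lemma positive_part_square_average:
  defines "Q \<equiv> (LINT x:B|lebesgue. (max (u x) 0)\<^sup>2)"
  shows "0 \<le> Q" and "(\<integral>\<^sup>+x\<in>B. ennreal ((max (u x) 0)\<^sup>2) \<partial>lebesgue) = ennreal Q"
    and "average B (\<lambda>x. (max (u x) 0)\<^sup>2) = Q / (unit_ball_vol (real DIM('a)) * r ^ DIM('a))"
proof -
  have "(\<integral>\<^sup>+x\<in>B. ennreal ((max (u x) 0)\<^sup>2) \<partial>lebesgue) \<le> (\<integral>\<^sup>+x. ennreal ((u x)\<^sup>2) * indicator B x \<partial>lebesgue)"
    by (intro nn_integral_mono mult_right_mono ennreal_leI abs_le_square_iff[THEN iffD1]) auto
  then have fin: "(\<integral>\<^sup>+x\<in>B. ennreal ((max (u x) 0)\<^sup>2) \<partial>lebesgue) < \<infinity>"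
    using u_square_finite by (rule le_less_trans)
  have eq: "(\<integral>\<^sup>+x\<in>B. ennreal ((max (u x) 0)\<^sup>2) \<partial>lebesgue) = (\<integral>\<^sup>+x. ennreal (indicator B x *\<^sub>R (max (u x) 0)\<^sup>2) \<partial>lebesgue)"
    by (intro nn_integral_cong) (auto simp: indicator_def)
  have "integrable lebesgue (\<lambda>x. indicator B x *\<^sub>R (max (u x) 0)\<^sup>2)"
    using fin unfolding eq by (intro integrableI_nonneg) auto
  then show "(\<integral>\<^sup>+x\<in>B. ennreal ((max (u x) 0)\<^sup>2) \<partial>lebesgue) = ennreal Q"
    unfolding eq Q_def set_lebesgue_integral_def by (intro nn_integral_eq_integral) auto
  show "0 \<le> Q"
    unfolding Q_def set_lebesgue_integral_def by (intro integral_nonneg_AE) auto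
  show "average B (\<lambda>x. (max (u x) 0)\<^sup>2) = Q / (unit_ball_vol (real DIM('a)) * r ^ DIM('a))"
    using r by (simp add: average_def Q_def content_ball)
qed

end

text \<open>
  The iteration contracts by \<open>\<eta> = q\<^sup>N / 4\<close> per step, where \<open>q = 2\<close> to the power \<open>-(N + \<alpha> + 1) / \<alpha>\<close>
  is the ratio of the Poincare radii. Below, \<open>sup_const\<close> is the least factor for which the initial
  radius, fixed by the ratio of \<open>\<eta>\<delta>\<close> and \<open>energy_const\<close>, is admissible.
\<close>

definition energy_const :: "real \<Rightarrow> real \<Rightarrow> real \<Rightarrow> real \<Rightarrow> real \<Rightarrow> real" where
  "energy_const n \<alpha> C1 C2 c = 8 powr \<alpha> + 6 * C1 * (truncation_const \<alpha> C2 * 16 powr \<alpha>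
     + 4 * (c * C2 * 2 powr (n + \<alpha>) / unit_ball_vol n) * 17 powr (n + \<alpha>))"

definition sup_const :: "real \<Rightarrow> real \<Rightarrow> real \<Rightarrow> real \<Rightarrow> real \<Rightarrow> real" where
  "sup_const n \<alpha> C1 C2 c =
     sqrt (8 * (4 * energy_const n \<alpha> C1 C2 c * 2 powr ((n + \<alpha> + 1) * n / \<alpha>)) powr (n / \<alpha>))"

text \<open>Every level \<open>k\<close> above the right-hand side meets both demands of the
  iteration: its first summand handles the tail, its second the starting condition, and both are
  non-negative.\<close>

lemma (in subsolution_setup) local_boundedness:
  defines "n \<equiv> real DIM('a)"
  defines "tail \<equiv> \<integral>\<^sup>+x\<in>- ball x0 (r / 2). ennreal (max (u x) 0 / norm (x - x0) powr (n + \<alpha>)) \<partial>lebesgue"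
  assumes P: "poincare_inequality \<mu> E \<alpha> C1" and C1: "0 \<le> C1"
    and U: "UJS K c" and c: "0 \<le> c"
    and \<delta>: "0 < \<delta>" "\<delta> \<le> 1"
  shows "esssup (lebesgue_on (ball x0 (r / 2))) (\<lambda>x. ereal (u x))
    \<le> enn2ereal (ennreal (\<delta> * r powr \<alpha>) * tail)
      + ereal (sup_const n \<alpha> C1 C2 c * (1 / \<delta> powr (n / (2 * \<alpha>))) * sqrt (average B (\<lambda>x. (max (u x) 0)\<^sup>2)))"
proof (cases "tail = \<infinity>")
  case True
  have "ennreal (\<delta> * r powr \<alpha>) * tail = \<infinity>"
    using True \<delta> r by (simp add: ennreal_mult_top)
  then show ?thesis by simp
next
  case False
  define T where "T = enn2real tail"
  have T: "0 \<le> T" "tail = ennreal T"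
    using False by (auto simp: T_def less_top)
  define \<omega> where "\<omega> = unit_ball_vol n"
  have \<omega>: "0 < \<omega>" by (simp add: \<omega>_def n_def)
  define \<Lambda> where "\<Lambda> = c * C2 * 2 powr (n + \<alpha>) / \<omega>"
  have \<Lambda>: "0 \<le> \<Lambda>" using c C2_nonneg \<omega> by (simp add: \<Lambda>_def)
  define A where "A = energy_const n \<alpha> C1 C2 c"
  have A: "8 powr \<alpha> \<le> A" "6 * C1 * (C3 * 16 powr \<alpha> + 4 * \<Lambda> * 17 powr (n + \<alpha>)) \<le> A"
  proof -
    have "0 \<le> 6 * C1 * (C3 * 16 powr \<alpha> + 4 * \<Lambda> * 17 powr (n + \<alpha>))"
      using C1 C3_nonneg \<Lambda> by simp
    moreover have "A = 8 powr \<alpha> + 6 * C1 * (C3 * 16 powr \<alpha> + 4 * \<Lambda> * 17 powr (n + \<alpha>))"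
      by (simp add: A_def energy_const_def \<Lambda>_def \<omega>_def)
    ultimately show "8 powr \<alpha> \<le> A" "6 * C1 * (C3 * 16 powr \<alpha> + 4 * \<Lambda> * 17 powr (n + \<alpha>)) \<le> A"
      by simp_all
  qed
  have A0: "0 < A"
    using A(1) by (rule less_le_trans[rotated]) simp
  define Q where "Q = (LINT x:B|lebesgue. (max (u x) 0)\<^sup>2)"
  note Q = positive_part_square_average[folded Q_def n_def, folded \<omega>_def]
  define m where "m = \<delta> * r powr \<alpha> * T + sup_const n \<alpha> C1 C2 c * (1 / \<delta> powr (n / (2 * \<alpha>))) * sqrt (Q / (\<omega> * r ^ DIM('a)))"
  have "0 \<le> sup_const n \<alpha> C1 C2 c"
    unfolding sup_const_def by (auto simp flip: A_def)
  then have g: "0 \<le> sup_const n \<alpha> C1 C2 c * (1 / \<delta> powr (n / (2 * \<alpha>))) * sqrt (Q / (\<omega> * r ^ DIM('a)))"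
    using Q(1) \<omega> r by (intro mult_nonneg_nonneg) auto
  define \<eta> where "\<eta> = ((2 powr (n + \<alpha> + 1)) powr (- (1 / \<alpha>))) ^ DIM('a) / 4"
  \<comment> \<open>The strict inequality guarantees 0 < k even when \<open>m\<close> is 0; the
    level gaps must be positive.\<close>
  have AE: "AE x in lebesgue_on (ball x0 (r / 2)). u x \<le> k" if "m < k" for k
  proof (rule AE_le_level[of "n + \<alpha>" C1 \<Lambda> T \<delta> k A Q])
    have kT: "\<delta> * r powr \<alpha> * T \<le> k"
      using that g unfolding m_def by linarith
    then show "\<delta> * r powr \<alpha> * T \<le> k" .
    have "0 \<le> \<delta> * r powr \<alpha> * T" using \<delta> T by simp
    then show k: "0 < k" using that g unfolding m_def by linarith
    show "K x y \<le> \<Lambda> * norm (x - y) powr - (n + \<alpha>)" if "x \<noteq> y" for x y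
      using kernel_upper_bound[OF U c that] by (simp add: \<Lambda>_def \<omega>_def n_def)
    have \<eta>0: "0 < \<eta>" by (simp add: \<eta>_def)
    have \<eta>_inv: "1 / \<eta> = 4 * 2 powr ((n + \<alpha> + 1) * n / \<alpha>)"
      by (simp add: \<eta>_def powr_powr n_def powr_power powr_minus field_simps)
    \<comment> \<open>The squares of \<open>sup_const\<close> and of the \<delta>-factor are, up to
      8, the reciprocal of the factor (\<eta>\<delta>/A)^(n/\<alpha>) in the N-th power of the
      initial radius. The starting condition thus reduces to k^2 dominating the squared second
      summand.\<close>
    have sup2: "(sup_const n \<alpha> C1 C2 c)\<^sup>2 = 8 * (A / \<eta>) powr (n / \<alpha>)"
    proof -
      have "4 * A * 2 powr ((n + \<alpha> + 1) * n / \<alpha>) = A / \<eta>"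
        unfolding divide_inverse[of A] inverse_eq_divide \<eta>_inv by (simp add: mult_ac)
      then show ?thesis unfolding sup_const_def A_def[symmetric] by simp
    qed
    have \<delta>2: "(1 / \<delta> powr (n / (2 * \<alpha>)))\<^sup>2 = 1 / \<delta> powr (n / \<alpha>)"
      by (simp add: power2_eq_square flip: powr_add)
    have "sup_const n \<alpha> C1 C2 c * (1 / \<delta> powr (n / (2 * \<alpha>))) * sqrt (Q / (\<omega> * r ^ DIM('a))) \<le> k"
      using that \<open>0 \<le> \<delta> * r powr \<alpha> * T\<close> unfolding m_def by linarith
    then have "(sup_const n \<alpha> C1 C2 c * (1 / \<delta> powr (n / (2 * \<alpha>))) * sqrt (Q / (\<omega> * r ^ DIM('a))))\<^sup>2 \<le> k\<^sup>2"
      using g by (rule power_mono)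
    then have k2: "8 * (A / \<eta>) powr (n / \<alpha>) * (1 / \<delta> powr (n / \<alpha>)) * (Q / (\<omega> * r ^ DIM('a))) \<le> k\<^sup>2"
      unfolding power_mult_distrib sup2 \<delta>2 using Q(1) \<omega> r by simp
    have S: "(r * (\<eta> * \<delta> / A) powr (1 / \<alpha>)) ^ DIM('a) = r ^ DIM('a) * (\<eta> * \<delta> / A) powr (n / \<alpha>)"
      unfolding power_mult_distrib using A0 \<eta>0 \<delta>(1) by (subst powr_power) (auto simp: n_def)
    have one: "(A / \<eta>) powr (n / \<alpha>) * (1 / \<delta> powr (n / \<alpha>)) * (\<eta> * \<delta> / A) powr (n / \<alpha>) = 1"
      using A0 \<eta>0 \<delta> by (simp add: powr_divide powr_mult)
    have cancel: "8 * X * Y * (Q / (\<omega> * W)) * (\<omega> * (W * Z)) = 8 * Q * (X * Y * Z)" if "W \<noteq> 0" for X Y Z W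
      using that \<omega> by (simp add: field_simps)
    have "8 * Q = 8 * (A / \<eta>) powr (n / \<alpha>) * (1 / \<delta> powr (n / \<alpha>)) * (Q / (\<omega> * r ^ DIM('a)))
        * (\<omega> * (r ^ DIM('a) * (\<eta> * \<delta> / A) powr (n / \<alpha>)))"
      by (subst cancel, use r in simp, unfold one) simp
    also have "\<dots> \<le> k\<^sup>2 * (\<omega> * (r ^ DIM('a) * (\<eta> * \<delta> / A) powr (n / \<alpha>)))"
      using \<omega> r by (intro mult_right_mono[OF k2]) auto
    finally show "8 * Q \<le> k\<^sup>2 * (unit_ball_vol (real DIM('a)) * (r * (((2 powr (n + \<alpha> + 1)) powr (- (1 / \<alpha>))) ^ DIM('a) / 4 * \<delta> / A) powr (1 / \<alpha>)) ^ DIM('a))"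
      unfolding \<eta>_def[symmetric] S by (simp only: \<omega>_def n_def)
  qed (use P C1 \<Lambda> T \<delta> A Q in \<open>auto simp: n_def tail_def\<close>)
  have "esssup (lebesgue_on (ball x0 (r / 2))) (\<lambda>x. ereal (u x)) \<le> ereal m"
  proof (rule ereal_le_epsilon2)
    fix e :: real assume "0 < e"
    then have "AE x in lebesgue_on (ball x0 (r / 2)). u x \<le> m + e"
      by (intro AE) simp
    then show "esssup (lebesgue_on (ball x0 (r / 2))) (\<lambda>x. ereal (u x)) \<le> ereal m + ereal e"
      by (intro esssup_I) (auto intro!: measurable_restrict_space1)
  qed
  also have "ereal m = enn2ereal (ennreal (\<delta> * r powr \<alpha>) * tail)
      + ereal (sup_const n \<alpha> C1 C2 c * (1 / \<delta> powr (n / (2 * \<alpha>))) * sqrt (average B (\<lambda>x. (max (u x) 0)\<^sup>2)))"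
    using T \<delta> by (simp add: m_def Q(3) enn2ereal_ennreal flip: ennreal_mult)
  finally show ?thesis .
qed

theorem theorem1p4:
  fixes \<alpha> C1 C2 chat :: real
  assumes "2 \<le> CARD('n::finite)"
    and "0 < \<alpha>" and "\<alpha> < 2"
    and "1 \<le> C1" and "1 \<le> C2" and "0 < chat"
  shows "\<exists>\<gamma>::real. \<forall>(E :: (real ^ 'n) set) K x0 R u r \<delta>.
     open E \<and> connected E \<and> bounded E \<and>
     symmetric_kernel K \<and>
     symmetric_family (kernel_measure K) \<and>
     poincare_inequality (kernel_measure K) E \<alpha> C1 \<and>
     decay_estimate (kernel_measure K) \<alpha> C2 \<and>
     UJS K chat \<and>
     ball x0 R \<subseteq> E \<and>
     local_weak_subsolution (kernel_measure K) E u \<and>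
     (AE x in lebesgue_on (ball x0 R). 0 \<le> u x) \<and>
     0 < r \<and> r < R \<and> 0 < \<delta> \<and> \<delta> \<le> 1
     \<longrightarrow>
     esssup (lebesgue_on (ball x0 (r / 2))) (\<lambda>x. ereal (u x))
       \<le> enn2ereal (ennreal (\<delta> * r powr \<alpha>) *
            (\<integral>\<^sup>+x\<in>- ball x0 (r / 2).
               ennreal (max (u x) 0 / norm (x - x0) powr (real CARD('n) + \<alpha>)) \<partial>lebesgue))
         + ereal (\<gamma> * (1 / \<delta> powr (real CARD('n) / (2 * \<alpha>))) *
             sqrt (average (ball x0 r) (\<lambda>x. (max (u x) 0)\<^sup>2)))"
\<comment> \<open>\<gamma> stays schematic until the final \<open>show\<close> instantiates it with
  \<open>sup_const\<close>. Being introduced before \<open>E\<close>, \<open>K\<close>,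
  \<open>u\<close>, \<open>r\<close> and \<delta>, it cannot depend on them.\<close>
proof (intro exI allI impI, elim conjE)
  fix E :: "(real ^ 'n) set" and K x0 R u r and \<delta> :: real
  assume K: "symmetric_kernel K" "poincare_inequality (kernel_measure K) E \<alpha> C1"
    "decay_estimate (kernel_measure K) \<alpha> C2" "UJS K chat" "ball x0 R \<subseteq> E"
    "local_weak_subsolution (kernel_measure K) E u" "0 < r" "r < R" "0 < \<delta>" "\<delta> \<le> 1"
  interpret subsolution_setup K \<alpha> C2 E u x0 r R
    using K assms by unfold_locales auto
  show "esssup (lebesgue_on (ball x0 (r / 2))) (\<lambda>x. ereal (u x))
       \<le> enn2ereal (ennreal (\<delta> * r powr \<alpha>) *
            (\<integral>\<^sup>+x\<in>- ball x0 (r / 2).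
               ennreal (max (u x) 0 / norm (x - x0) powr (real CARD('n) + \<alpha>)) \<partial>lebesgue))
         + ereal (sup_const (real CARD('n)) \<alpha> C1 C2 chat * (1 / \<delta> powr (real CARD('n) / (2 * \<alpha>))) *
             sqrt (average (ball x0 r) (\<lambda>x. (max (u x) 0)\<^sup>2)))"
    using local_boundedness[OF K(2) _ K(4) _ K(9,10)] assms by simp
qed

end
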